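(* Let $S$ be a rank-one Lie group of Iwasawa type with its global coordinates $(t,x)$, eigenvalues $0<\lambda_1<\dots<\lambda_m$ with multiplicities $n_1,\dots,n_m$, and $n=n_1\lambda_1+\dots+n_m\lambda_m$. Let $h:S\to\mathbb{C}$ be a (smooth) function independent of $t$ and suppose that its tension tree $\{h^i_\alpha\}$ is of finite degree $r$. For an integer $i\ge 1$ and $\alpha\in I_i^m$ put $$\Lambda^k_\alpha=\sum_{j=1}^k\lambda_{\alpha_j},\qquad k=1,\dots,i.$$ Further, for integers $p,i\ge 1$ and $\alpha\in I_i^m$ define $$f^i_\alpha(t,p)=\frac{t^{2\Lambda^i_\alpha}}{\prod_{k=1}^i\Lambda^k_\alpha}\sum_{j=0}^{p-1}\ \sum_{\ell_1+\dots+\ell_i=j}\frac{(-1)^{i+j}\,2^{j-i}\prod_{k=1}^j(p-k)}{\prod_{k=1}^i(2\Lambda^k_\alpha-n)^{\ell_k+1}}\,\log(t)^{p-j-1},$$ $$g^i_\alpha(t,p)=\frac{t^{2\Lambda^i_\alpha+n}}{\prod_{k=1}^i\Lambda^k_\alpha}\sum_{j=0}^{p-1}\ \sum_{\ell_1+\dots+\ell_i=j}\frac{(-1)^{i+j}\,2^{j-i}\prod_{k=1}^j(p-k)}{\prod_{k=1}^i(2\Lambda^k_\alpha+n)^{\ell_k+1}}\,\log(t)^{p-j-1},$$ where the inner sums run over non-negative integers $\ell_1,\dots,\ell_i$, and where in the definition of $f^i_\alpha$ (and hence in every statement involving $\phi_p$ below, but not in those involving only $\psi_p$) it is additionally assumed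 that, for all $i\ge1$ and $\alpha\in I_i^m$, $$\prod_{k=1}^i(2\Lambda^k_\alpha-n)\neq 0\quad\text{if}\quad h^i_\alpha\neq 0$$ (terms with $h^i_\alpha\equiv0$ are understood to be zero in the sums below). Then the functions $\phi_p,\psi_p:S\to\mathbb{C}$ given by $$\phi_p(t,x)=h(x)\log(t)^{p-1}+\sum_{i=1}^r\sum_{\alpha\in I_i^m}h^i_\alpha(x)\,f^i_\alpha(t,p),$$ $$\psi_p(t,x)=h(x)\,t^n\log(t)^{p-1}+\sum_{i=1}^r\sum_{\alpha\in I_i^m}h^i_\alpha(x)\,g^i_\alpha(t,p)$$ are proper $p$-harmonic on $S$. Furthermore, for any non-zero $(a,b)\in\mathbb{C}^2$ the linear combination $a\phi_p+b\psi_p$ is proper $p$-harmonic on $S$.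
   Context: **Lie groups of Iwasawa type.** A Lie group of Iwasawa type is a simply connected solvable Lie group $S$ with a left-invariant Riemannian metric $g$ whose Lie algebra $\mathfrak{s}$ satisfies: (1) $\mathfrak{s}=\mathfrak{a}\oplus\mathfrak{n}$, where $\mathfrak{n}=[\mathfrak{s},\mathfrak{s}]$ and $\mathfrak{a}=\mathfrak{n}^\perp$ is abelian; (2) $\mathrm{ad}(A)|_{\mathfrak{n}}:\mathfrak{n}\to\mathfrak{n}$ is symmetric for all $A\in\mathfrak{a}$; (3) $\mathrm{ad}(A)|_{\mathfrak{n}}$ is positive-definite for some $A\in\mathfrak{a}$. Its rank is $\dim\mathfrak{a}$. Throughout the rank is one. **Structure.** Let $A\in\mathfrak{a}$ be the unique unit vector with $\mathrm{ad}(A)|_{\mathfrak n}$ positive-definite, let $0<\lambda_1<\dots<\lambda_m$ be the distinct eigenvalues of $\mathrm{ad}(A)|_{\mathfrak n}$, with (non-trivial) eigenspaces $\mathfrak{n}_1,\dots,\mathfrak{n}_m$ of dimensions $n_i=\dim\mathfrak{n}_i$; then $\mathfrak{n}=\bigoplus_i\mathfrak{n}_i$ orthogonally. Let $N$ be the simply connected Lie group with Lie algebra $\mathfrak{n}$ (which is nilpotent, so $\exp_{\mathfrak n}:\mathfrak{n}\to N$ is a diffeomorphism). Then $S=\mathbb{R}^+\ltimes N$ with group law $(t,\exp_{\mathfrak n}(X))(s,\exp_{\mathfrak n}(Y))=(ts,\exp_{\mathfrak n}(X)\exp_{\mathfrak n}(\mu(t)Y))$, where $\mu(t)Y=t^{\lambda_1}Y^1+\dots+t^{\lambda_m}Y^m$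 for $Y=Y^1+\dots+Y^m$, $Y^i\in\mathfrak{n}_i$, and $A$ corresponds to the tangent vector at $s=0$ of $s\mapsto(e^s,\exp_{\mathfrak n}(0))$. **Coordinates.** Fix an orthonormal basis $\{X^i_j: j=1,\dots,n_i\}$ of each $\mathfrak{n}_i$. Global coordinates $(t,x)=(t,(x^i_j)_{1\le i\le m,1\le j\le n_i})\in\mathbb{R}^+\times\mathbb{R}^{n_1+\dots+n_m}$ on $S$ are defined by assigning $(t,x)$ to the point $(t,\exp_{\mathfrak n}(\sum_{i,j}x^i_jX^i_j))$. A function is "independent of $t$" if it depends only on $x$. **$p$-harmonic functions.** $\tau$ denotes the Laplace-Beltrami operator of $(S,g)$ (divergence of gradient) extended complex-linearly to complex-valued functions; $\tau^0(\phi)=\phi$, $\tau^p(\phi)=\tau(\tau^{p-1}(\phi))$. For a positive integer $p$, $\phi$ is $p$-harmonic if $\tau^p(\phi)=0$, and proper $p$-harmonic if it is $p$-harmonic but not $(p-1)$-harmonic, i.e. $\tau^{p-1}(\phi)$ is not identically zero. **Tension tree.** For an integer $i\ge1$ let $I_i^m=\{\alpha\in\mathbb{N}^i: 1\le\alpha_1,\dots,\alpha_i\le m\}$. For any $h:S\to\mathbb{C}$ independent of $t$, $\tau(h)$ is of the form $\sum_{k=1}^m h_k(x)t^{2\lambda_k}$ with functions $h_k$ independent of $t$. The tension tree of $h$ is the unique collection $\{h^i_\alpha:S\to\mathbb{C}\mid i\ge1,\ \alpha\in I_i^m\}$ of functions independent of $t$ such that $$\tau(h)=\sum_{k=1}^m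 h^1_k(x)\,t^{2\lambda_k},\qquad \tau(h^i_\alpha)=\sum_{k=1}^m h^{i+1}_{(\alpha,k)}(x)\,t^{2\lambda_k}.$$ If there is an integer $r\ge0$ such that $h^{r+1}_\alpha\equiv0$ for all $\alpha\in I_{r+1}^m$, the smallest such $r$ is the degree of the tension tree; otherwise the degree is infinite. Empty products equal $1$, empty sums equal $0$, and $\log(t)^0=1$.
   Formalization: The function h is additionally assumed not to be identically zero; for h = 0 the tension tree has degree 0 and φ_p = ψ_p = 0, which is not proper p-harmonic, so the literal claim fails there. *)

theory Defs
  imports "HOL-Analysis.Analysis" "HOL-Algebra.Solvable_Groups"
begin

section \<open>Smooth functions on open sets\<close>

fun Ck_on :: "nat \<Rightarrow> 'a::real_normed_vector set \<Rightarrow> ('a \<Rightarrow> 'b::real_normed_vector) \<Rightarrow> bool" where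
  "Ck_on 0 U f \<longleftrightarrow> continuous_on U f"
| "Ck_on (Suc k) U f \<longleftrightarrow>
     (\<forall>x\<in>U. f differentiable (at x)) \<and> (\<forall>v. Ck_on k U (\<lambda>x. frechet_derivative f (at x) v))"

definition smooth_on :: "'a::real_normed_vector set \<Rightarrow> ('a \<Rightarrow> 'b::real_normed_vector) \<Rightarrow> bool" where
  "smooth_on U f \<longleftrightarrow> (\<forall>k. Ck_on k U f)"


section \<open>Lie groups in a global chart\<close>

text \<open>
  All Lie groups below are diffeomorphic to an open subset of a coordinate space, so a Lie group
  is a group (in the sense of \<^theory>\<open>HOL-Algebra.Group\<close>) whose carrier is an open set and whose
  operations are smooth. Every tangent space is identified with the coordinate space itself.
\<close>

definition lie_group :: "('a::real_normed_vector) monoid \<Rightarrow> bool" where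
  "lie_group G \<longleftrightarrow> group G \<and> open (carrier G) \<and>
     smooth_on (carrier G \<times> carrier G) (\<lambda>(p, q). p \<otimes>\<^bsub>G\<^esub> q) \<and>
     smooth_on (carrier G) (\<lambda>p. inv\<^bsub>G\<^esub> p)"

definition dL :: "('a::real_normed_vector) monoid \<Rightarrow> 'a \<Rightarrow> 'a \<Rightarrow> 'a \<Rightarrow> 'a" where
  "dL G p q = frechet_derivative (\<lambda>x. p \<otimes>\<^bsub>G\<^esub> x) (at q)"

definition left_inv_field :: "('a::real_normed_vector) monoid \<Rightarrow> 'a \<Rightarrow> 'a \<Rightarrow> 'a" where
  "left_inv_field G v p = dL G p \<one>\<^bsub>G\<^esub> v"

definition vf_bracket :: "('a::real_normed_vector \<Rightarrow> 'a) \<Rightarrow> ('a \<Rightarrow> 'a) \<Rightarrow> 'a \<Rightarrow> 'a" where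
  "vf_bracket V W p = frechet_derivative W (at p) (V p) - frechet_derivative V (at p) (W p)"

text \<open>The Lie algebra of \<open>G\<close> is the tangent space at \<open>\<one>\<close>, i.e. the whole coordinate space.\<close>

definition lie_bracket :: "('a::real_normed_vector) monoid \<Rightarrow> 'a \<Rightarrow> 'a \<Rightarrow> 'a" where
  "lie_bracket G u v = vf_bracket (left_inv_field G u) (left_inv_field G v) \<one>\<^bsub>G\<^esub>"

text \<open>A metric is given as \<open>g p u v\<close>: base point, then two tangent vectors.\<close>

definition riemannian_metric_on :: "'a::real_normed_vector set \<Rightarrow> ('a \<Rightarrow> 'a \<Rightarrow> 'a \<Rightarrow> real) \<Rightarrow> bool" where
  "riemannian_metric_on U g \<longleftrightarrow>
     (\<forall>p\<in>U. bilinear (g p) \<and> (\<forall>u v. g p u v = g p v u) \<and> (\<forall>v. v \<noteq> 0 \<longrightarrow> g p v v > 0)) \<and>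
     (\<forall>u v. smooth_on U (\<lambda>p. g p u v))"

definition left_invariant_metric :: "('a::real_normed_vector) monoid \<Rightarrow> ('a \<Rightarrow> 'a \<Rightarrow> 'a \<Rightarrow> real) \<Rightarrow> bool" where
  "left_invariant_metric G g \<longleftrightarrow> riemannian_metric_on (carrier G) g \<and>
     (\<forall>p\<in>carrier G. \<forall>q\<in>carrier G. \<forall>u v. g (p \<otimes>\<^bsub>G\<^esub> q) (dL G p q u) (dL G p q v) = g q u v)"


section \<open>Lie groups of Iwasawa type\<close>

definition n_alg :: "('a::real_normed_vector) monoid \<Rightarrow> 'a set" where
  "n_alg G = span {lie_bracket G X Y | X Y. True}"

definition a_alg :: "('a::real_normed_vector) monoid \<Rightarrow> ('a \<Rightarrow> 'a \<Rightarrow> 'a \<Rightarrow> real) \<Rightarrow> 'a set" where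
  "a_alg G g = {X. \<forall>Y\<in>n_alg G. g \<one>\<^bsub>G\<^esub> X Y = 0}"

definition ad_pos_def :: "('a::real_normed_vector) monoid \<Rightarrow> ('a \<Rightarrow> 'a \<Rightarrow> 'a \<Rightarrow> real) \<Rightarrow> 'a \<Rightarrow> bool" where
  "ad_pos_def G g A \<longleftrightarrow> (\<forall>X\<in>n_alg G. X \<noteq> 0 \<longrightarrow> g \<one>\<^bsub>G\<^esub> (lie_bracket G A X) X > 0)"

text \<open>
  That the Lie algebra is the direct sum of \<^term>\<open>a_alg G g\<close> and \<^term>\<open>n_alg G\<close> is automatic, the
  former being the orthogonal complement of the latter.
\<close>

definition iwasawa_type :: "('a::real_normed_vector) monoid \<Rightarrow> ('a \<Rightarrow> 'a \<Rightarrow> 'a \<Rightarrow> real) \<Rightarrow> bool" where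
  "iwasawa_type G g \<longleftrightarrow>
     lie_group G \<and> simply_connected (carrier G) \<and> solvable G \<and> left_invariant_metric G g \<and>
     (\<forall>A\<in>a_alg G g. \<forall>B\<in>a_alg G g. lie_bracket G A B = 0) \<and>
     (\<forall>A\<in>a_alg G g. \<forall>X\<in>n_alg G. \<forall>Y\<in>n_alg G.
        g \<one>\<^bsub>G\<^esub> (lie_bracket G A X) Y = g \<one>\<^bsub>G\<^esub> X (lie_bracket G A Y)) \<and>
     (\<exists>A\<in>a_alg G g. ad_pos_def G g A)"

definition iwasawa_rank :: "('a::real_normed_vector) monoid \<Rightarrow> ('a \<Rightarrow> 'a \<Rightarrow> 'a \<Rightarrow> real) \<Rightarrow> nat" where
  "iwasawa_rank G g = dim (a_alg G g)"

definition eigenspace_ad :: "('a::real_normed_vector) monoid \<Rightarrow> 'a \<Rightarrow> real \<Rightarrow> 'a set" where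
  "eigenspace_ad G A c = {X \<in> n_alg G. lie_bracket G A X = c *\<^sub>R X}"


section \<open>Global coordinates on rank-one groups\<close>

text \<open>
  The finite type \<open>'k\<close> indexes the orthonormal eigenbasis of the nilradical, i.e. it plays the role
  of the set of pairs \<open>(i, j)\<close>; \<open>idx k\<close> is the first component \<open>i\<close> of such a pair. A point of the
  group is a vector indexed by \<open>'k option\<close>: the component at \<open>None\<close> is \<open>t\<close>, the components at
  \<open>Some k\<close> form \<open>x\<close>.
\<close>

type_synonym 'k coords = "(real, 'k option) vec"

definition pt :: "real \<Rightarrow> real ^ 'k::finite \<Rightarrow> 'k coords" where
  "pt t x = (\<chi> c. case c of None \<Rightarrow> t | Some k \<Rightarrow> x $ k)"

definition t_of :: "('k::finite) coords \<Rightarrow> real" where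
  "t_of q = q $ None"

definition x_of :: "('k::finite) coords \<Rightarrow> real ^ 'k" where
  "x_of q = (\<chi> k. q $ Some k)"

definition A_vec :: "('k::finite) coords" where
  "A_vec = axis None 1"

definition X_vec :: "'k::finite \<Rightarrow> 'k coords" where
  "X_vec k = axis (Some k) 1"

definition mu :: "(nat \<Rightarrow> real) \<Rightarrow> ('k::finite \<Rightarrow> nat) \<Rightarrow> real \<Rightarrow> real ^ 'k \<Rightarrow> real ^ 'k" where
  "mu lam idx t y = (\<chi> k. t powr lam (idx k) * y $ k)"

text \<open>
  \<open>N\<close> is written in exponential coordinates: \<open>x\<close> stands for the point \<open>exp (\<Sum>k. x\<^sub>k X\<^sub>k)\<close>. This is
  expressed by saying that \<open>s \<mapsto> s x\<close> is a one-parameter subgroup for each \<open>x\<close>; its initial velocity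
  is \<open>x\<close>, hence the exponential map is the identity in these coordinates. At the identity of \<open>S\<close>,
  \<^const>\<open>A_vec\<close> is the velocity at \<open>s = 0\<close> of \<open>s \<mapsto> pt (exp s) 0\<close>, and the coordinate vectors
  \<^term>\<open>X_vec k\<close> are the chosen basis vectors of the Lie algebra of \<open>N\<close>.
\<close>

definition iwasawa_coordinates ::
  "('k::finite) coords monoid \<Rightarrow> ('k coords \<Rightarrow> 'k coords \<Rightarrow> 'k coords \<Rightarrow> real) \<Rightarrow> (real ^ 'k) monoid \<Rightarrow>
     nat \<Rightarrow> (nat \<Rightarrow> real) \<Rightarrow> ('k \<Rightarrow> nat) \<Rightarrow> bool" where
  "iwasawa_coordinates S g N m lam idx \<longleftrightarrow>
     lie_group N \<and> carrier N = UNIV \<and>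
     (\<forall>x a b. (a *\<^sub>R x) \<otimes>\<^bsub>N\<^esub> (b *\<^sub>R x) = (a + b) *\<^sub>R x) \<and>
     carrier S = {q. t_of q > 0} \<and>
     (\<forall>t>0. \<forall>s>0. \<forall>x y. pt t x \<otimes>\<^bsub>S\<^esub> pt s y = pt (t * s) (x \<otimes>\<^bsub>N\<^esub> mu lam idx t y)) \<and>
     A_vec \<in> a_alg S g \<and> g \<one>\<^bsub>S\<^esub> A_vec A_vec = 1 \<and> ad_pos_def S g A_vec \<and>
     strict_mono_on {1..m} lam \<and>
     lam ` {1..m} = {c. \<exists>X\<in>n_alg S. X \<noteq> 0 \<and> lie_bracket S A_vec X = c *\<^sub>R X} \<and>
     range idx \<subseteq> {1..m} \<and>
     (\<forall>k l. g \<one>\<^bsub>S\<^esub> (X_vec k) (X_vec l) = (if k = l then 1 else 0)) \<and>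
     (\<forall>i\<in>{1..m}. span (X_vec ` {k. idx k = i}) = eigenspace_ad S A_vec (lam i))"


section \<open>Laplace-Beltrami operator and p-harmonic functions\<close>

definition grad :: "(real ^ 'd \<Rightarrow> real ^ 'd \<Rightarrow> real ^ 'd \<Rightarrow> real) \<Rightarrow> (real ^ 'd \<Rightarrow> real) \<Rightarrow> real ^ 'd \<Rightarrow> real ^ 'd" where
  "grad g f p = (THE v. \<forall>w. g p v w = frechet_derivative f (at p) w)"

definition vol_density :: "(real ^ 'd \<Rightarrow> real ^ 'd \<Rightarrow> real ^ 'd \<Rightarrow> real) \<Rightarrow> real ^ 'd \<Rightarrow> real" where
  "vol_density g p = sqrt (det (\<chi> i j. g p (axis i 1) (axis j 1)))"

definition divergence :: "(real ^ 'd \<Rightarrow> real ^ 'd \<Rightarrow> real ^ 'd \<Rightarrow> real) \<Rightarrow> (real ^ 'd \<Rightarrow> real ^ 'd) \<Rightarrow> real ^ 'd \<Rightarrow> real" where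
  "divergence g V p =
     (\<Sum>i\<in>UNIV. frechet_derivative (\<lambda>q. vol_density g q * V q $ i) (at p) (axis i 1)) / vol_density g p"

definition tau :: "(real ^ 'd \<Rightarrow> real ^ 'd \<Rightarrow> real ^ 'd \<Rightarrow> real) \<Rightarrow> (real ^ 'd \<Rightarrow> complex) \<Rightarrow> real ^ 'd \<Rightarrow> complex" where
  "tau g \<phi> p = Complex (divergence g (grad g (\<lambda>q. Re (\<phi> q))) p) (divergence g (grad g (\<lambda>q. Im (\<phi> q))) p)"

definition p_harmonic_on ::
  "(real ^ 'd) set \<Rightarrow> (real ^ 'd \<Rightarrow> real ^ 'd \<Rightarrow> real ^ 'd \<Rightarrow> real) \<Rightarrow> nat \<Rightarrow> (real ^ 'd \<Rightarrow> complex) \<Rightarrow> bool" where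
  "p_harmonic_on U g p \<phi> \<longleftrightarrow> smooth_on U \<phi> \<and> (\<forall>q\<in>U. (tau g ^^ p) \<phi> q = 0)"

definition proper_p_harmonic_on ::
  "(real ^ 'd) set \<Rightarrow> (real ^ 'd \<Rightarrow> real ^ 'd \<Rightarrow> real ^ 'd \<Rightarrow> real) \<Rightarrow> nat \<Rightarrow> (real ^ 'd \<Rightarrow> complex) \<Rightarrow> bool" where
  "proper_p_harmonic_on U g p \<phi> \<longleftrightarrow> p_harmonic_on U g p \<phi> \<and> (\<exists>q\<in>U. (tau g ^^ (p - 1)) \<phi> q \<noteq> 0)"


section \<open>Tension trees\<close>

text \<open>
  A function on \<open>S\<close> that is independent of \<open>t\<close> is represented by a function of \<open>x\<close> alone, and is
  viewed as a function on \<open>S\<close> through \<open>h \<circ> x_of\<close>. Multi-indices are lists, with \<open>\<alpha>\<^sub>j\<close> being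
  \<open>\<alpha> ! (j - 1)\<close>; the value of a tree \<open>H\<close> at the empty list is irrelevant. Smoothness of
  the members of the tree is what makes \<^const>\<open>tau\<close> meaningful on them.
\<close>

definition multi_idx :: "nat \<Rightarrow> nat \<Rightarrow> nat list set" where
  "multi_idx m i = {\<alpha>. length \<alpha> = i \<and> set \<alpha> \<subseteq> {1..m}}"

definition tension_tree ::
  "('k::finite) coords monoid \<Rightarrow> ('k coords \<Rightarrow> 'k coords \<Rightarrow> 'k coords \<Rightarrow> real) \<Rightarrow>
     nat \<Rightarrow> (nat \<Rightarrow> real) \<Rightarrow> (real ^ 'k \<Rightarrow> complex) \<Rightarrow> (nat list \<Rightarrow> real ^ 'k \<Rightarrow> complex) \<Rightarrow> bool" where
  "tension_tree S g m lam h H \<longleftrightarrow>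
     (\<forall>i\<ge>1. \<forall>\<alpha>\<in>multi_idx m i. smooth_on (carrier S) (H \<alpha> \<circ> x_of)) \<and>
     (\<forall>q\<in>carrier S. tau g (h \<circ> x_of) q =
        (\<Sum>k=1..m. H [k] (x_of q) * of_real (t_of q powr (2 * lam k)))) \<and>
     (\<forall>i\<ge>1. \<forall>\<alpha>\<in>multi_idx m i. \<forall>q\<in>carrier S. tau g (H \<alpha> \<circ> x_of) q =
        (\<Sum>k=1..m. H (\<alpha> @ [k]) (x_of q) * of_real (t_of q powr (2 * lam k))))"

definition tree_vanishes_at :: "nat \<Rightarrow> (nat list \<Rightarrow> real ^ 'k \<Rightarrow> complex) \<Rightarrow> nat \<Rightarrow> bool" where
  "tree_vanishes_at m H i \<longleftrightarrow> (\<forall>\<alpha>\<in>multi_idx m i. \<forall>x. H \<alpha> x = 0)"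

definition tree_has_degree :: "nat \<Rightarrow> (nat list \<Rightarrow> real ^ 'k \<Rightarrow> complex) \<Rightarrow> nat \<Rightarrow> bool" where
  "tree_has_degree m H r \<longleftrightarrow>
     tree_vanishes_at m H (r + 1) \<and> (\<forall>s. tree_vanishes_at m H (s + 1) \<longrightarrow> r \<le> s)"


section \<open>The functions in the construction\<close>

definition Lam :: "(nat \<Rightarrow> real) \<Rightarrow> nat list \<Rightarrow> nat \<Rightarrow> real" where
  "Lam lam \<alpha> k = (\<Sum>j=1..k. lam (\<alpha> ! (j - 1)))"

text \<open>The exponents \<open>l\<^sub>1, \<dots>, l\<^sub>i\<close> are again a list, \<open>l\<^sub>k\<close> being \<open>ls ! (k - 1)\<close>.\<close>

definition f_fun :: "(nat \<Rightarrow> real) \<Rightarrow> real \<Rightarrow> nat list \<Rightarrow> real \<Rightarrow> nat \<Rightarrow> real" where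
  "f_fun lam n \<alpha> t p = (let i = length \<alpha> in
     t powr (2 * Lam lam \<alpha> i) / (\<Prod>k=1..i. Lam lam \<alpha> k) *
     (\<Sum>j=0..p-1. \<Sum>ls | length ls = i \<and> sum_list ls = j.
        (-1) ^ (i + j) * 2 powi (int j - int i) * (\<Prod>k=1..j. real p - real k) /
        (\<Prod>k=1..i. (2 * Lam lam \<alpha> k - n) ^ (ls ! (k - 1) + 1)) * ln t ^ (p - j - 1)))"

definition g_fun :: "(nat \<Rightarrow> real) \<Rightarrow> real \<Rightarrow> nat list \<Rightarrow> real \<Rightarrow> nat \<Rightarrow> real" where
  "g_fun lam n \<alpha> t p = (let i = length \<alpha> in
     t powr (2 * Lam lam \<alpha> i + n) / (\<Prod>k=1..i. Lam lam \<alpha> k) *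
     (\<Sum>j=0..p-1. \<Sum>ls | length ls = i \<and> sum_list ls = j.
        (-1) ^ (i + j) * 2 powi (int j - int i) * (\<Prod>k=1..j. real p - real k) /
        (\<Prod>k=1..i. (2 * Lam lam \<alpha> k + n) ^ (ls ! (k - 1) + 1)) * ln t ^ (p - j - 1)))"

definition phi_fun ::
  "nat \<Rightarrow> (nat \<Rightarrow> real) \<Rightarrow> real \<Rightarrow> (real ^ 'k::finite \<Rightarrow> complex) \<Rightarrow> (nat list \<Rightarrow> real ^ 'k \<Rightarrow> complex) \<Rightarrow>
     nat \<Rightarrow> nat \<Rightarrow> 'k coords \<Rightarrow> complex" where
  "phi_fun m lam n h H r p q =
     h (x_of q) * of_real (ln (t_of q) ^ (p - 1)) +
     (\<Sum>i=1..r. \<Sum>\<alpha>\<in>multi_idx m i. H \<alpha> (x_of q) * of_real (f_fun lam n \<alpha> (t_of q) p))"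

definition psi_fun ::
  "nat \<Rightarrow> (nat \<Rightarrow> real) \<Rightarrow> real \<Rightarrow> (real ^ 'k::finite \<Rightarrow> complex) \<Rightarrow> (nat list \<Rightarrow> real ^ 'k \<Rightarrow> complex) \<Rightarrow>
     nat \<Rightarrow> nat \<Rightarrow> 'k coords \<Rightarrow> complex" where
  "psi_fun m lam n h H r p q =
     h (x_of q) * of_real (t_of q powr n * ln (t_of q) ^ (p - 1)) +
     (\<Sum>i=1..r. \<Sum>\<alpha>\<in>multi_idx m i. H \<alpha> (x_of q) * of_real (g_fun lam n \<alpha> (t_of q) p))"

definition nonresonant ::
  "nat \<Rightarrow> (nat \<Rightarrow> real) \<Rightarrow> real \<Rightarrow> (nat list \<Rightarrow> real ^ 'k \<Rightarrow> complex) \<Rightarrow> bool" where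
  "nonresonant m lam n H \<longleftrightarrow>
     (\<forall>i\<ge>1. \<forall>\<alpha>\<in>multi_idx m i. (\<exists>x. H \<alpha> x \<noteq> 0) \<longrightarrow> (\<Prod>k=1..i. 2 * Lam lam \<alpha> k - n) \<noteq> 0)"

end

theory Submission
  imports Defs
begin

text \<open>
  The left-invariant orthonormal frame consists of \<open>t \<partial>\<^sub>t\<close> and the fields \<open>t powr \<lambda>\<^sub>k\<close> times a field that
  involves only \<open>x\<close>. In this frame the tension field of a product \<open>u(t) F(x)\<close> is
  \<open>u \<tau>(F) + (t\<^sup>2 u'' + (1 - n) t u') F\<close>, where the part of the volume density depending on \<open>x\<close> cancels.

  The polynomials in \<open>log t\<close> occurring in the functions \<open>f\<close> and \<open>g\<close> are the Taylor coefficients in \<open>z\<close> of an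
  eigenfunction \<open>t powr z h + \<dots>\<close> of \<open>\<tau>\<close> with eigenvalue \<open>z\<^sup>2 - n z\<close>, respectively \<open>z\<^sup>2 + n z\<close>. Comparing
  coefficients gives \<open>\<tau>(\<phi>\<^sub>p) = (p - 1)(p - 2) \<phi>\<^bsub>p-2\<^esub> - n (p - 1) \<phi>\<^bsub>p-1\<^esub>\<close> and the same with \<open>-n\<close> for \<open>n\<close> and
  \<open>\<psi>\<close> for \<open>\<phi>\<close>. Hence \<open>\<tau>\<^sup>p\<close> annihilates all combinations, while \<open>\<tau>\<^bsup>p-1\<^esup>\<close> leaves nonzero multiples of \<open>\<phi>\<^sub>1\<close>
  and \<open>\<psi>\<^sub>1\<close>, which are independent because they behave like \<open>h\<close> and \<open>t powr n h\<close> as \<open>t \<rightarrow> 0\<close>.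
\<close>

section \<open>Calculus of differentiable functions\<close>

lemma Ck_on_Suc_imp: "Ck_on (Suc k) U f \<Longrightarrow> Ck_on k U f"
proof (induction k arbitrary: f)
  case 0
  then show ?case
    by (auto intro!: continuous_at_imp_continuous_on differentiable_imp_continuous_within)
next
  case (Suc k)
  then show ?case by (metis Ck_on.simps(2))
qed

text \<open>\<open>frechet_derivative\<close> is a Hilbert choice among the derivatives at the
  point, and these depend only on the germ. So the identity holds also where neither function is
  differentiable, which \<open>tau_cong\<close> exploits.\<close>

lemma frechet_derivative_cong_open:
  assumes "open U" "x \<in> U" "\<And>y. y \<in> U \<Longrightarrow> f y = f' y"
  shows "frechet_derivative f (at x) = frechet_derivative f' (at x)"
proof -
  have "(f has_derivative D) (at x) \<longleftrightarrow> (f' has_derivative D) (at x)" for D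
    using assms has_derivative_transform_within_open[of f D x UNIV U f']
      has_derivative_transform_within_open[of f' D x UNIV U f] by auto
  then show ?thesis by (simp add: frechet_derivative_def)
qed

lemma differentiable_cong_open:
  assumes "open U" "x \<in> U" "\<And>y. y \<in> U \<Longrightarrow> f y = f' y"
  shows "f differentiable (at x) \<longleftrightarrow> f' differentiable (at x)"
  unfolding differentiable_def
  using assms has_derivative_transform_within_open[of f _ x UNIV U f']
      has_derivative_transform_within_open[of f' _ x UNIV U f] by metis

lemma Ck_on_cong:
  assumes "open U" "\<And>y. y \<in> U \<Longrightarrow> f y = f' y"
  shows "Ck_on k U f \<longleftrightarrow> Ck_on k U f'"
  using assms(2)
proof (induction k arbitrary: f f')
  case 0
  then show ?case by (auto intro: continuous_on_cong)
next
  case (Suc k)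
  have "Ck_on k U (\<lambda>x. frechet_derivative f (at x) v) \<longleftrightarrow>
        Ck_on k U (\<lambda>x. frechet_derivative f' (at x) v)" for v
    by (rule Suc.IH) (use frechet_derivative_cong_open[OF assms(1) _ Suc.prems] in auto)
  then show ?case
    using differentiable_cong_open[OF assms(1) _ Suc.prems] by auto
qed

lemma has_derivative_frechet:
  "f differentiable (at x) \<Longrightarrow> (f has_derivative frechet_derivative f (at x)) (at x)"
  by (simp add: frechet_derivative_works)

lemma frechet_derivative_eq: "(f has_derivative D) (at x) \<Longrightarrow> frechet_derivative f (at x) = D"
  by (metis frechet_derivative_at)

text \<open>The zero function reproduces itself under differentiation, so the induction closes; a
  general constant then takes one further step.\<close>

lemma Ck_on_0_fun: "Ck_on k U (\<lambda>x. 0)"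
  by (induction k) auto

lemma Ck_on_const: "Ck_on k U (\<lambda>x. c)"
  by (cases k) (auto simp: Ck_on_0_fun)

lemma Ck_on_add:
  assumes "open U" "Ck_on k U f" "Ck_on k U f'"
  shows "Ck_on k U (\<lambda>x. f x + f' x)"
  using assms(2,3)
proof (induction k arbitrary: f f')
  case 0
  then show ?case by (simp add: continuous_on_add)
next
  case (Suc k)
  have D: "frechet_derivative (\<lambda>x. f x + f' x) (at x) v =
      frechet_derivative f (at x) v + frechet_derivative f' (at x) v" if "x \<in> U" for x v
    using Suc.prems that
    by (subst frechet_derivative_eq[OF has_derivative_add[OF has_derivative_frechet has_derivative_frechet]]) auto
  have "Ck_on k U (\<lambda>x. frechet_derivative (\<lambda>x. f x + f' x) (at x) v)" for v
    by (subst Ck_on_cong[OF assms(1) D]) (use Suc in auto)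
  then show ?case using Suc.prems by auto
qed

lemma Ck_on_sum:
  assumes "open U" "\<And>i. i \<in> I \<Longrightarrow> Ck_on k U (f i)"
  shows "Ck_on k U (\<lambda>x. \<Sum>i\<in>I. f i x)"
  using assms(2)
  by (induction I rule: infinite_finite_induct) (auto simp: Ck_on_0_fun Ck_on_add assms(1))

lemma Ck_on_mult:
  fixes f f' :: "'a::real_normed_vector \<Rightarrow> 'b::real_normed_algebra"
  assumes "open U" "Ck_on k U f" "Ck_on k U f'"
  shows "Ck_on k U (\<lambda>x. f x * f' x)"
  using assms(2,3)
proof (induction k arbitrary: f f')
  case 0
  then show ?case by (simp add: continuous_on_mult)
next
  case (Suc k)
  have D: "frechet_derivative (\<lambda>x. f x * f' x) (at x) v =
      f x * frechet_derivative f' (at x) v + frechet_derivative f (at x) v * f' x" if "x \<in> U" for x v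
    using Suc.prems that
    by (subst frechet_derivative_eq[OF has_derivative_mult[OF has_derivative_frechet has_derivative_frechet]]) auto
  have "Ck_on k U f" "Ck_on k U f'" using Suc.prems Ck_on_Suc_imp by blast+
  then have "Ck_on k U (\<lambda>x. frechet_derivative (\<lambda>x. f x * f' x) (at x) v)" for v
    by (subst Ck_on_cong[OF assms(1) D]) (use Suc in \<open>auto intro!: Ck_on_add assms(1)\<close>)
  then show ?case using Suc.prems by auto
qed

lemma smooth_on_cong:
  "open U \<Longrightarrow> (\<And>y. y \<in> U \<Longrightarrow> f y = f' y) \<Longrightarrow> smooth_on U f \<longleftrightarrow> smooth_on U f'"
  by (simp add: smooth_on_def Ck_on_cong[of U f f'])

lemma smooth_on_sum:
  "open U \<Longrightarrow> (\<And>i. i \<in> I \<Longrightarrow> smooth_on U (f i)) \<Longrightarrow> smooth_on U (\<lambda>x. \<Sum>i\<in>I. f i x)"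
  by (simp add: smooth_on_def Ck_on_sum)

lemma smooth_on_mult:
  fixes f f' :: "'a::real_normed_vector \<Rightarrow> 'b::real_normed_algebra"
  shows "open U \<Longrightarrow> smooth_on U f \<Longrightarrow> smooth_on U f' \<Longrightarrow> smooth_on U (\<lambda>x. f x * f' x)"
  by (simp add: smooth_on_def Ck_on_mult)

lemma smooth_on_const: "smooth_on U (\<lambda>x. c)"
  by (simp add: smooth_on_def Ck_on_const)

section \<open>The Laplace-Beltrami operator in an orthonormal frame\<close>

definition pd :: "'d::finite \<Rightarrow> (real ^ 'd \<Rightarrow> 'b::real_normed_vector) \<Rightarrow> real ^ 'd \<Rightarrow> 'b" where
  "pd j f q = frechet_derivative f (at q) (axis j 1)"

lemma bilinear_axis_expansion:
  fixes B :: "real ^ 'd::finite \<Rightarrow> real ^ 'd \<Rightarrow> real"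
  assumes "bilinear B"
  shows "B u v = (\<Sum>i\<in>UNIV. \<Sum>j\<in>UNIV. u $ i * v $ j * B (axis i 1) (axis j 1))"
proof -
  have "B u v = B (\<Sum>i\<in>UNIV. u $ i *\<^sub>R axis i 1) (\<Sum>j\<in>UNIV. v $ j *\<^sub>R axis j 1)"
    using basis_expansion[of u] basis_expansion[of v] by (simp add: scalar_mult_eq_scaleR)
  then show ?thesis
    using assms
    by (simp add: bilinear_sum[OF assms] sum.cartesian_product bilinear_lmul bilinear_rmul mult.assoc)
qed

lemma linear_axis_expansion:
  fixes D :: "real ^ 'd::finite \<Rightarrow> 'b::real_vector"
  assumes "linear D"
  shows "D v = (\<Sum>j\<in>UNIV. v $ j *\<^sub>R D (axis j 1))"
proof -
  have "D v = D (\<Sum>j\<in>UNIV. v $ j *\<^sub>R axis j 1)"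
    using basis_expansion[of v] by (simp add: scalar_mult_eq_scaleR)
  then show ?thesis
    by (simp add: linear_sum[OF assms] linear_scale[OF assms])
qed

lemma pd_cong: "open U \<Longrightarrow> q \<in> U \<Longrightarrow> (\<And>y. y \<in> U \<Longrightarrow> f y = f' y) \<Longrightarrow> pd j f q = pd j f' q"
  by (simp add: pd_def frechet_derivative_cong_open[of U q f f'])

lemma pd_eq: "(f has_derivative D) (at q) \<Longrightarrow> pd j f q = D (axis j 1)"
  by (simp add: pd_def frechet_derivative_eq)

lemma pd_mult:
  fixes f f' :: "real ^ 'd::finite \<Rightarrow> 'b::real_normed_algebra"
  assumes "f differentiable (at q)" "f' differentiable (at q)"
  shows "pd j (\<lambda>x. f x * f' x) q = f q * pd j f' q + pd j f q * f' q"
  by (subst pd_eq[OF has_derivative_mult[OF has_derivative_frechet has_derivative_frechet]])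
     (auto simp: assms pd_def)

lemma pd_add:
  assumes "f differentiable (at q)" "f' differentiable (at q)"
  shows "pd j (\<lambda>x. f x + f' x) q = pd j f q + pd j f' q"
  by (subst pd_eq[OF has_derivative_add[OF has_derivative_frechet has_derivative_frechet]])
     (auto simp: assms pd_def)

lemma pd_sum:
  assumes "\<And>i. i \<in> I \<Longrightarrow> f i differentiable (at q)"
  shows "pd j (\<lambda>x. \<Sum>i\<in>I. f i x) q = (\<Sum>i\<in>I. pd j (f i) q)"
  by (subst pd_eq[OF has_derivative_sum[OF has_derivative_frechet]])
     (auto simp: assms pd_def)

lemma pd_bounded_linear:
  assumes "bounded_linear T" "f differentiable (at q)"
  shows "pd j (\<lambda>x. T (f x)) q = T (pd j f q)"
  by (subst pd_eq[OF bounded_linear.has_derivative[OF assms(1) has_derivative_frechet]])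
     (auto simp: assms pd_def)

lemma pd_const [simp]: "pd j (\<lambda>x. c) q = 0"
  by (simp add: pd_def)

lemma differentiable_bounded_linear:
  assumes "bounded_linear T" "f differentiable (at q)"
  shows "(\<lambda>x. T (f x)) differentiable (at q)"
  using assms bounded_linear.has_derivative unfolding differentiable_def by blast

lemma differentiable_prod:
  fixes f :: "'i \<Rightarrow> 'a::real_normed_vector \<Rightarrow> 'b::real_normed_field"
  assumes "\<And>i. i \<in> I \<Longrightarrow> f i differentiable (at x)"
  shows "(\<lambda>x. \<Prod>i\<in>I. f i x) differentiable (at x)"
  using assms by (induction I rule: infinite_finite_induct) auto

lemma differentiable_det:
  fixes P :: "'a::real_normed_vector \<Rightarrow> real ^ 'd::finite ^ 'd"
  assumes "\<And>i j. (\<lambda>x. P x $ i $ j) differentiable (at x)"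
  shows "(\<lambda>x. det (P x)) differentiable (at x)"
  unfolding det_def
  by (intro differentiable_sum differentiable_mult differentiable_prod ballI assms differentiable_const) auto

text \<open>Bookkeeping for \<open>lapl_mult\<close>: \<open>F\<close> and \<open>G\<close> stand
  for the first and second derivatives of the factor \<open>f\<close>, and \<open>K\<close> and
  \<open>H\<close> for those of the factor \<open>h\<close>.\<close>

lemma sum2_product_rule:
  fixes a H G :: "'d::finite \<Rightarrow> 'd \<Rightarrow> complex"
  shows "(\<Sum>i\<in>UNIV. \<Sum>j\<in>UNIV. a i j * (f * H i j + F i * K j + (F j * K i + G i j * h))) =
    f * (\<Sum>i\<in>UNIV. \<Sum>j\<in>UNIV. a i j * H i j) + (\<Sum>i\<in>UNIV. \<Sum>j\<in>UNIV. a i j * (F i * K j)) +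
    ((\<Sum>i\<in>UNIV. \<Sum>j\<in>UNIV. a i j * (F j * K i)) + (\<Sum>i\<in>UNIV. \<Sum>j\<in>UNIV. a i j * G i j) * h)"
  by (simp add: ring_distribs sum.distrib sum_distrib_left sum_distrib_right mult.assoc mult.left_commute)

lemma sum_product_rule:
  fixes b :: "'d::finite \<Rightarrow> complex"
  shows "(\<Sum>j\<in>UNIV. b j * (f * K j + F j * h)) = f * (\<Sum>j\<in>UNIV. b j * K j) + (\<Sum>j\<in>UNIV. b j * F j) * h"
  by (simp add: ring_distribs sum.distrib sum_distrib_left sum_distrib_right mult.assoc mult.left_commute)

text \<open>The metric of the group is accessible through its left-invariant frame, so inverse
  metric, density, gradient and Laplacian are all rewritten in terms of the components of an
  orthonormal frame.\<close>

locale orthonormal_frame =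
  fixes U :: "(real ^ 'd::finite) set"
    and g :: "real ^ 'd \<Rightarrow> real ^ 'd \<Rightarrow> real ^ 'd \<Rightarrow> real"
    and E :: "'d \<Rightarrow> real ^ 'd \<Rightarrow> real ^ 'd"
  assumes open_U: "open U"
    and bilinear_g: "p \<in> U \<Longrightarrow> bilinear (g p)"
    and orthonormal: "p \<in> U \<Longrightarrow> g p (E c p) (E d p) = (if c = d then 1 else 0)"
    and differentiable_E: "p \<in> U \<Longrightarrow> (\<lambda>q. E c q $ i) differentiable (at p)"
begin

definition fmat :: "real ^ 'd \<Rightarrow> real ^ 'd ^ 'd" where
  "fmat p = (\<chi> c. E c p)"

definition gmat :: "real ^ 'd \<Rightarrow> real ^ 'd ^ 'd" where
  "gmat p = (\<chi> i j. g p (axis i 1) (axis j 1))"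

text \<open>The entries of the inverse of the Gram matrix, by \<open>gmat_inverse\<close> and
  \<open>acoef_matrix\<close>.\<close>

definition acoef :: "'d \<Rightarrow> 'd \<Rightarrow> real ^ 'd \<Rightarrow> real" where
  "acoef i j p = (\<Sum>c\<in>UNIV. E c p $ i * E c p $ j)"

text \<open>The first-order coefficients of the Laplacian, obtained by expanding its divergence
  form.\<close>

definition bcoef :: "'d \<Rightarrow> real ^ 'd \<Rightarrow> real" where
  "bcoef j p = (\<Sum>i\<in>UNIV. pd i (\<lambda>q. vol_density g q * acoef i j q) p) / vol_density g p"

text \<open>Orthonormality as the matrix equation F G F^T = 1 with the frame vectors as rows of F.
  It yields the inverse of G as F^T F and, through determinants, the volume density.\<close>

lemma frame_gram:
  assumes "p \<in> U"
  shows "fmat p ** (gmat p ** transpose (fmat p)) = mat 1"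
proof -
  have "(\<Sum>i\<in>UNIV. E c p $ i * (\<Sum>j\<in>UNIV. gmat p $ i $ j * E d p $ j)) = (if c = d then 1 else 0)" for c d
    using orthonormal[OF assms, of c d]
    by (subst (asm) bilinear_axis_expansion[OF bilinear_g[OF assms]])
       (simp add: gmat_def sum_distrib_left mult_ac)
  then show ?thesis
    by (simp add: vec_eq_iff matrix_matrix_mult_def fmat_def transpose_def mat_def)
qed

lemma gmat_inverse:
  assumes "p \<in> U"
  shows "gmat p ** (transpose (fmat p) ** fmat p) = mat 1"
    and "(transpose (fmat p) ** fmat p) ** gmat p = mat 1"
proof -
  show "gmat p ** (transpose (fmat p) ** fmat p) = mat 1"
    using frame_gram[OF assms] by (metis matrix_left_right_inverse matrix_mul_assoc)
  then show "(transpose (fmat p) ** fmat p) ** gmat p = mat 1"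
    by (metis matrix_left_right_inverse)
qed

lemma acoef_matrix: "(transpose (fmat p) ** fmat p) $ i $ j = acoef i j p"
  by (simp add: matrix_matrix_mult_def transpose_def fmat_def acoef_def)

lemma det_fmat_nz: "p \<in> U \<Longrightarrow> det (fmat p) \<noteq> 0"
  using arg_cong[OF frame_gram, of p det] by (auto simp: det_mul)

lemma vol_density_frame:
  assumes "p \<in> U"
  shows "vol_density g p = 1 / \<bar>det (fmat p)\<bar>"
proof -
  have "det (fmat p) * (det (gmat p) * det (fmat p)) = 1"
    using arg_cong[OF frame_gram[OF assms], of det] by (simp add: det_mul)
  then have "det (gmat p) = (1 / \<bar>det (fmat p)\<bar>)\<^sup>2"
    using det_fmat_nz[OF assms] by (simp add: field_simps power2_eq_square)
  then show ?thesis
    by (simp add: vol_density_def gmat_def[symmetric])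
qed

lemma vol_density_pos: "p \<in> U \<Longrightarrow> vol_density g p > 0"
  using det_fmat_nz by (simp add: vol_density_frame)

lemma differentiable_vol_density:
  assumes "p \<in> U"
  shows "vol_density g differentiable (at p)"
proof -
  have "(\<lambda>q. det (fmat q)) differentiable (at p)"
    by (intro differentiable_det) (simp add: fmat_def differentiable_E assms)
  \<comment> \<open>The absolute value is the norm of the reals, which is differentiable away from
    0.\<close>
  then have "(\<lambda>q. \<bar>det (fmat q)\<bar>) differentiable (at p)"
    using differentiable_compose[of "norm :: real \<Rightarrow> real" "\<lambda>q. det (fmat q)" p UNIV]
      differentiable_norm_at[OF det_fmat_nz[OF assms]] by simp
  then have "(\<lambda>q. 1 / \<bar>det (fmat q)\<bar>) differentiable (at p)"
    by (rule differentiable_divide[OF differentiable_const]) (simp add: det_fmat_nz assms)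
  then show ?thesis
    using differentiable_cong_open[OF open_U assms, of "vol_density g" "\<lambda>q. 1 / \<bar>det (fmat q)\<bar>"]
      vol_density_frame by blast
qed

lemma differentiable_acoef: "p \<in> U \<Longrightarrow> acoef i j differentiable (at p)"
  unfolding acoef_def[abs_def] by (rule differentiable_sum) (simp_all add: differentiable_E differentiable_mult)

text \<open>For row vectors the defining condition of the gradient reads v G = d, where d collects
  the partial derivatives. Invertibility of G makes d F^T F its only solution, as the definite
  description requires.\<close>

lemma grad_frame:
  assumes p: "p \<in> U" and f: "f differentiable (at p)"
  shows "grad g f p $ i = (\<Sum>j\<in>UNIV. acoef j i p * pd j f p)"
proof -
  define D where "D = frechet_derivative f (at p)"
  define d where "d = (\<chi> j. D (axis j 1))"
  define V where "V = d v* (transpose (fmat p) ** fmat p)"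
  have lin: "linear D"
    using f by (simp add: D_def linear_frechet_derivative)
  have g_eq: "g p v w = (v v* gmat p) \<bullet> w" for v w
    by (subst bilinear_axis_expansion[OF bilinear_g[OF p]], subst sum.swap)
       (simp only: inner_vec_def vector_matrix_mult_def gmat_def sum_distrib_left vec_lambda_beta inner_real_def mult_ac)
  have D_eq: "D w = d \<bullet> w" for w
    by (subst linear_axis_expansion[OF lin]) (simp add: inner_vec_def d_def mult_ac)
  have V: "V v* gmat p = d"
    unfolding V_def by (simp only: vector_matrix_mul_assoc gmat_inverse(2)[OF p] vector_matrix_mul_rid)
  have V_unique: "v = V" if "v v* gmat p = d" for v
    unfolding V_def that[symmetric]
    by (simp only: vector_matrix_mul_assoc gmat_inverse(1)[OF p] vector_matrix_mul_rid)
  have "(\<forall>w. g p v w = D w) \<longleftrightarrow> v v* gmat p = d" for v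
    by (simp only: D_eq g_eq vector_eq_rdot)
  then have "grad g f p = (THE v. v v* gmat p = d)"
    unfolding grad_def D_def[symmetric] by (simp only:)
  also have "\<dots> = V"
    using V V_unique by (rule the_equality)
  finally show ?thesis
    unfolding V_def vector_matrix_mult_def acoef_matrix d_def pd_def D_def by (simp only: vec_lambda_beta mult.commute)
qed

lemma acoef_commute: "acoef i j p = acoef j i p"
  by (simp add: acoef_def mult.commute)

text \<open>Product rule for the density times \<open>acoef\<close> against \<open>pd j f\<close>;
  the derivatives falling on the first factor are collected in \<open>bcoef\<close>.\<close>

lemma divergence_grad_frame:
  assumes p: "p \<in> U" and f: "\<And>q. q \<in> U \<Longrightarrow> f differentiable (at q)"
    and f': "\<And>j. pd j f differentiable (at p)"
  shows "divergence g (grad g f) p =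
    (\<Sum>i\<in>UNIV. \<Sum>j\<in>UNIV. acoef i j p * pd i (pd j f) p) + (\<Sum>j\<in>UNIV. bcoef j p * pd j f p)"
proof -
  let ?w = "vol_density g"
  have "frechet_derivative (\<lambda>q. ?w q * grad g f q $ i) (at p) (axis i 1) =
        pd i (\<lambda>q. \<Sum>j\<in>UNIV. (?w q * acoef i j q) * pd j f q) p" for i
    unfolding pd_def[symmetric]
    by (rule pd_cong[OF open_U p])
       (simp add: grad_frame f sum_distrib_left mult_ac acoef_commute[of i])
  also have "pd i (\<lambda>q. \<Sum>j\<in>UNIV. (?w q * acoef i j q) * pd j f q) p =
     (\<Sum>j\<in>UNIV. ?w p * acoef i j p * pd i (pd j f) p + pd i (\<lambda>q. ?w q * acoef i j q) p * pd j f p)" for i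
    using p by (subst pd_sum)
      (auto simp: pd_mult f' differentiable_acoef differentiable_vol_density)
  finally have "divergence g (grad g f) p = (\<Sum>i\<in>UNIV. \<Sum>j\<in>UNIV. ?w p * acoef i j p * pd i (pd j f) p
      + pd i (\<lambda>q. ?w q * acoef i j q) p * pd j f p) / ?w p"
    by (simp add: divergence_def)
  also have "\<dots> = (\<Sum>i\<in>UNIV. \<Sum>j\<in>UNIV. acoef i j p * pd i (pd j f) p) +
     (\<Sum>i\<in>UNIV. \<Sum>j\<in>UNIV. pd i (\<lambda>q. ?w q * acoef i j q) p / ?w p * pd j f p)"
    using vol_density_pos[OF p]
    by (simp add: sum_divide_distrib add_divide_distrib sum.distrib)
  also have "(\<Sum>i\<in>UNIV. \<Sum>j\<in>UNIV. pd i (\<lambda>q. ?w q * acoef i j q) p / ?w p * pd j f p) =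
     (\<Sum>j\<in>UNIV. bcoef j p * pd j f p)"
    by (subst sum.swap) (simp add: bcoef_def sum_divide_distrib sum_distrib_right)
  finally show ?thesis .
qed

text \<open>\<open>tau\<close> handles real and imaginary parts separately. This is the
  complex-linear expression it agrees with on C^2 functions, and on it sums and products are easy to
  treat.\<close>

definition lapl :: "(real ^ 'd \<Rightarrow> complex) \<Rightarrow> real ^ 'd \<Rightarrow> complex" where
  "lapl f p = (\<Sum>i\<in>UNIV. \<Sum>j\<in>UNIV. of_real (acoef i j p) * pd i (pd j f) p) +
     (\<Sum>j\<in>UNIV. of_real (bcoef j p) * pd j f p)"

lemma Ck2D:
  assumes "Ck_on 2 U f" "p \<in> U"
  shows "f differentiable (at p)" "pd j f differentiable (at p)"
  using assms by (auto simp: numeral_2_eq_2 pd_def[abs_def])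

lemma tau_frame:
  assumes "Ck_on 2 U \<phi>" and p: "p \<in> U"
  shows "tau g \<phi> p = lapl \<phi> p"
proof -
  \<comment> \<open>\<open>T\<close> is \<open>Re\<close> or \<open>Im\<close>; both commute with
    partial derivatives and with real coefficients.\<close>
  have *: "divergence g (grad g (\<lambda>q. T (\<phi> q))) p = T (lapl \<phi> p)"
    if T: "bounded_linear T" and Tm: "\<And>r z. T (of_real r * z) = r * T z" for T :: "complex \<Rightarrow> real"
  proof -
    have d: "(\<lambda>q. T (\<phi> q)) differentiable (at q)" if "q \<in> U" for q
      using differentiable_bounded_linear[OF T] Ck2D(1)[OF assms(1) that] .
    have pd1: "pd j (\<lambda>q. T (\<phi> q)) q = T (pd j \<phi> q)" if "q \<in> U" for j q
      using pd_bounded_linear[OF T] Ck2D(1)[OF assms(1) that] .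
    have pd2: "pd j (\<lambda>q. T (\<phi> q)) differentiable (at p)" for j
      using differentiable_bounded_linear[OF T Ck2D(2)[OF assms]]
        differentiable_cong_open[OF open_U p, of "pd j (\<lambda>q. T (\<phi> q))" "\<lambda>q. T (pd j \<phi> q)"] pd1 by blast
    have pd3: "pd i (pd j (\<lambda>q. T (\<phi> q))) p = T (pd i (pd j \<phi>) p)" for i j
      using pd_bounded_linear[OF T Ck2D(2)[OF assms]]
        pd_cong[OF open_U p, of "pd j (\<lambda>q. T (\<phi> q))" "\<lambda>q. T (pd j \<phi> q)"] pd1 by simp
    show ?thesis
      by (simp add: divergence_grad_frame[OF p d pd2] pd1 pd3 p lapl_def Tm
          linear_add[OF bounded_linear.linear[OF T]] linear_sum[OF bounded_linear.linear[OF T]])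
  qed
  show ?thesis
    by (simp add: tau_def * bounded_linear_Re bounded_linear_Im)
qed

lemma lapl_sum:
  assumes f: "\<And>s. s \<in> I \<Longrightarrow> Ck_on 2 U (f s)" and p: "p \<in> U"
  shows "lapl (\<lambda>q. \<Sum>s\<in>I. f s q) p = (\<Sum>s\<in>I. lapl (f s) p)"
proof -
  have 1: "pd j (\<lambda>q. \<Sum>s\<in>I. f s q) q = (\<Sum>s\<in>I. pd j (f s) q)" if "q \<in> U" for j q
    by (rule pd_sum) (use Ck2D(1)[OF f] that in auto)
  have 2: "pd i (pd j (\<lambda>q. \<Sum>s\<in>I. f s q)) p = (\<Sum>s\<in>I. pd i (pd j (f s)) p)" for i j
    using pd_cong[OF open_U p, of "pd j (\<lambda>q. \<Sum>s\<in>I. f s q)" "\<lambda>q. \<Sum>s\<in>I. pd j (f s) q"] 1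
      pd_sum[of I "\<lambda>s. pd j (f s)" p i] Ck2D(2)[OF f p] by simp
  show ?thesis
    by (simp add: lapl_def 1 2 p sum.distrib sum_distrib_left sum.swap[of _ I])
qed

lemma lapl_mult:
  assumes f: "Ck_on 2 U f" and h: "Ck_on 2 U h" and p: "p \<in> U"
  shows "lapl (\<lambda>q. f q * h q) p = f p * lapl h p + lapl f p * h p +
    2 * (\<Sum>i\<in>UNIV. \<Sum>j\<in>UNIV. of_real (acoef i j p) * (pd i f p * pd j h p))"
proof -
  have 1: "pd j (\<lambda>q. f q * h q) q = f q * pd j h q + pd j f q * h q" if "q \<in> U" for j q
    by (rule pd_mult) (use Ck2D(1)[OF f] Ck2D(1)[OF h] that in auto)
  have 2: "pd i (pd j (\<lambda>q. f q * h q)) p = f p * pd i (pd j h) p + pd i f p * pd j h p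
     + (pd j f p * pd i h p + pd i (pd j f) p * h p)" for i j
    using pd_cong[OF open_U p, of "pd j (\<lambda>q. f q * h q)" "\<lambda>q. f q * pd j h q + pd j f q * h q"] 1
      Ck2D[OF f p] Ck2D[OF h p]
    by (simp add: pd_add pd_mult)
  \<comment> \<open>The two mixed sums agree by symmetry of \<open>acoef\<close>, whence the factor
    2.\<close>
  have 3: "(\<Sum>i\<in>UNIV. \<Sum>j\<in>UNIV. of_real (acoef i j p) * (pd j f p * pd i h p)) =
     (\<Sum>i\<in>UNIV. \<Sum>j\<in>UNIV. of_real (acoef i j p) * (pd i f p * pd j h p))"
    by (subst sum.swap) (simp add: acoef_commute)
  show ?thesis
    unfolding lapl_def 2 1[OF p] sum2_product_rule sum_product_rule 3
    by (simp only: ring_distribs mult_2 add_ac)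
qed

end

section \<open>The left-invariant frame of a rank-one group\<close>

lemma t_of_pt [simp]: "t_of (pt t x) = t"
  and x_of_pt [simp]: "x_of (pt t x) = x"
  and pt_t_of_x_of [simp]: "pt (t_of q) (x_of q) = q"
  by (auto simp: t_of_def x_of_def pt_def vec_eq_iff split: option.split)

lemma bounded_linear_t_of: "bounded_linear t_of"
  by (rule linear_conv_bounded_linear[THEN iffD1]) (auto simp: t_of_def intro!: linearI)

lemma bounded_linear_x_of: "bounded_linear x_of"
  by (rule linear_conv_bounded_linear[THEN iffD1]) (auto simp: x_of_def vec_eq_iff intro!: linearI)

lemma bounded_linear_pt: "bounded_linear (\<lambda>z. pt (fst z) (snd z))"
  by (rule linear_conv_bounded_linear[THEN iffD1])
     (auto simp: pt_def vec_eq_iff split: option.split intro!: linearI)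

lemma has_derivative_t_of: "(t_of has_derivative t_of) (at q)"
  and has_derivative_x_of: "(x_of has_derivative x_of) (at q)"
  using bounded_linear_t_of bounded_linear_x_of by (auto intro: bounded_linear_imp_has_derivative)

lemma has_derivative_pt:
  assumes "(f has_derivative f') (at q)" "(F has_derivative F') (at q)"
  shows "((\<lambda>q. pt (f q) (F q)) has_derivative (\<lambda>u. pt (f' u) (F' u))) (at q)"
  using bounded_linear.has_derivative[OF bounded_linear_pt has_derivative_Pair[OF assms]] by simp

lemma pt_nth: "pt t x $ c = (case c of None \<Rightarrow> t | Some k \<Rightarrow> x $ k)"
  by (simp add: pt_def)

lemma axis_None_pt: "axis None 1 = pt 1 0"
  and axis_Some_pt: "axis (Some k) 1 = pt 0 (axis k 1)"
  by (auto simp: pt_def axis_def vec_eq_iff split: option.split)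

lemma t_of_axis [simp]: "t_of (axis None 1) = 1" "t_of (axis (Some k) 1) = 0"
  and x_of_axis [simp]: "x_of (axis None 1) = 0"
  by (simp_all add: axis_None_pt axis_Some_pt)

lemma sum_UNIV_option:
  "(\<Sum>c\<in>(UNIV :: 'k::finite option set). f c) = f None + (\<Sum>k\<in>UNIV. f (Some k))"
  by (simp add: UNIV_option_conv sum.reindex)

lemma prod_UNIV_option:
  "(\<Prod>c\<in>(UNIV :: 'k::finite option set). f c) = f None * (\<Prod>k\<in>UNIV. f (Some k))"
  by (simp add: UNIV_option_conv prod.reindex)

text \<open>Only the composite is known to be differentiable. It is unchanged by the projection that
  freezes t, so the chain rule and uniqueness of derivatives force its derivative to ignore the
  t-direction.\<close>

lemma pd_None_x_of:
  assumes "(\<lambda>q. F (x_of q)) differentiable (at p)"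
  shows "pd None (\<lambda>q. F (x_of q)) p = 0"
proof -
  define D where "D = frechet_derivative (\<lambda>q. F (x_of q)) (at p)"
  have D: "((\<lambda>q. F (x_of q)) has_derivative D) (at p)"
    unfolding D_def by (rule has_derivative_frechet[OF assms])
  have inner: "((\<lambda>q. pt (t_of p) (x_of q)) has_derivative (\<lambda>u. pt 0 (x_of u))) (at p)"
    by (intro has_derivative_pt has_derivative_const has_derivative_x_of)
  have "((\<lambda>q. F (x_of (pt (t_of p) (x_of q)))) has_derivative (\<lambda>u. D (pt 0 (x_of u)))) (at p)"
    by (rule has_derivative_compose[OF inner]) (simp add: D)
  then have "D = (\<lambda>u. D (pt 0 (x_of u)))"
    using D by (auto intro: has_derivative_unique)
  then have "D (axis None 1) = D (pt 0 (x_of (axis None 1)))" by (rule fun_cong)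
  also have "pt 0 (x_of (axis None 1)) = (0 :: 'a coords)"
    by (simp add: pt_def vec_eq_iff split: option.split)
  also have "D 0 = 0" using D by (simp add: has_derivative_bounded_linear linear_simps)
  finally show ?thesis by (simp add: pd_def D_def)
qed

lemma has_derivative_t_of_compose:
  assumes "(u has_real_derivative u') (at (t_of p))"
  shows "((\<lambda>q. u (t_of q)) has_derivative (\<lambda>v. t_of v * u')) (at p)"
  using has_derivative_compose[OF has_derivative_t_of assms[unfolded has_field_derivative_def]]
  by (simp add: mult.commute)

lemma has_derivative_of_real_t_of:
  assumes "(u has_real_derivative u') (at (t_of p))"
  shows "((\<lambda>q. complex_of_real (u (t_of q))) has_derivative (\<lambda>v. of_real (t_of v * u'))) (at p)"
  by (rule has_derivative_of_real[OF has_derivative_t_of_compose[OF assms]])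

section \<open>Group law and left-invariant frame in the chart\<close>

locale iwasawa_chart =
  fixes S :: "('k::finite) coords monoid"
    and g :: "'k coords \<Rightarrow> 'k coords \<Rightarrow> 'k coords \<Rightarrow> real"
    and N :: "(real ^ 'k) monoid"
    and m :: nat
    and lam :: "nat \<Rightarrow> real"
    and idx :: "'k \<Rightarrow> nat"
  assumes type: "iwasawa_type S g"
    and coords: "iwasawa_coordinates S g N m lam idx"
begin

text \<open>The number n of the theorem, summed over the eigenbasis rather than over the distinct
  eigenvalues; \<open>hdim_eq\<close> reconciles the two.\<close>

definition hdim :: real where
  "hdim = (\<Sum>k\<in>UNIV. lam (idx k))"

lemma lie_group_N: "lie_group N"
  and carrier_N: "carrier N = UNIV"
  and one_param_N: "\<forall>x a b. (a *\<^sub>R x) \<otimes>\<^bsub>N\<^esub> (b *\<^sub>R x) = (a + b) *\<^sub>R x"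
  and carrier_S: "carrier S = {q. t_of q > 0}"
  and mult_S: "\<forall>t>0. \<forall>s>0. \<forall>x y. pt t x \<otimes>\<^bsub>S\<^esub> pt s y = pt (t * s) (x \<otimes>\<^bsub>N\<^esub> mu lam idx t y)"
  and A_vec_in_a_alg: "A_vec \<in> a_alg S g"
  and A_vec_unit: "g \<one>\<^bsub>S\<^esub> A_vec A_vec = 1"
  and ad_pos_def_A: "ad_pos_def S g A_vec"
  and lam_eigenvalues: "lam ` {1..m} = {c. \<exists>X\<in>n_alg S. X \<noteq> 0 \<and> lie_bracket S A_vec X = c *\<^sub>R X}"
  and range_idx: "range idx \<subseteq> {1..m}"
  and X_vec_orthonormal: "\<forall>k l. g \<one>\<^bsub>S\<^esub> (X_vec k) (X_vec l) = (if k = l then 1 else 0)"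
  and span_X_vec: "\<forall>i\<in>{1..m}. span (X_vec ` {k. idx k = i}) = eigenspace_ad S A_vec (lam i)"
proof -
  note c = coords[unfolded iwasawa_coordinates_def]
  from c show "lie_group N" by (elim conjE)
  from c show "carrier N = UNIV" by (elim conjE)
  from c show "\<forall>x a b. (a *\<^sub>R x) \<otimes>\<^bsub>N\<^esub> (b *\<^sub>R x) = (a + b) *\<^sub>R x" by (elim conjE)
  from c show "carrier S = {q. t_of q > 0}" by (elim conjE)
  from c show "\<forall>t>0. \<forall>s>0. \<forall>x y. pt t x \<otimes>\<^bsub>S\<^esub> pt s y = pt (t * s) (x \<otimes>\<^bsub>N\<^esub> mu lam idx t y)"
    by (elim conjE)
  from c show "A_vec \<in> a_alg S g" by (elim conjE)
  from c show "g \<one>\<^bsub>S\<^esub> A_vec A_vec = 1" by (elim conjE)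
  from c show "ad_pos_def S g A_vec" by (elim conjE)
  from c show "lam ` {1..m} = {c. \<exists>X\<in>n_alg S. X \<noteq> 0 \<and> lie_bracket S A_vec X = c *\<^sub>R X}" by (elim conjE)
  from c show "range idx \<subseteq> {1..m}" by (elim conjE)
  from c show "\<forall>k l. g \<one>\<^bsub>S\<^esub> (X_vec k) (X_vec l) = (if k = l then 1 else 0)" by (elim conjE)
  from c show "\<forall>i\<in>{1..m}. span (X_vec ` {k. idx k = i}) = eigenspace_ad S A_vec (lam i)" by (elim conjE)
qed

lemma idx_in: "idx k \<in> {1..m}"
  using range_idx by (rule subsetD) (rule rangeI)

lemma open_carrier: "open (carrier S)"
  using type by (simp add: iwasawa_type_def lie_group_def)

lemma group_S: "group S" and group_N: "group N"
  using type lie_group_N by (simp_all add: iwasawa_type_def lie_group_def)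

text \<open>The one-parameter law at the vector 0 makes 0 idempotent, and the neutral element is the
  only idempotent of a group. The same argument gives \<open>one_S\<close>.\<close>

lemma one_N: "\<one>\<^bsub>N\<^esub> = 0"
proof -
  have "(0 *\<^sub>R 0) \<otimes>\<^bsub>N\<^esub> (0 *\<^sub>R 0) = (0 + 0) *\<^sub>R (0 :: real ^ 'k)"
    using one_param_N by (elim allE)
  then have "0 \<otimes>\<^bsub>N\<^esub> 0 = (0 :: real ^ 'k)" by simp
  then show ?thesis
    using group.l_cancel_one[OF group_N, of 0 0] by (simp add: carrier_N)
qed

lemma mult_N_0 [simp]: "x \<otimes>\<^bsub>N\<^esub> 0 = x"
  using monoid.r_one[OF group.is_monoid[OF group_N], of x] by (simp add: one_N carrier_N)

lemma mu_0 [simp]: "mu lam idx t 0 = 0"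
  by (simp add: mu_def vec_eq_iff)

lemma one_S: "\<one>\<^bsub>S\<^esub> = pt 1 0"
  using group.l_cancel_one[OF group_S, of "pt 1 0" "pt 1 0"] mult_S[rule_format, of 1 1 0 0]
  by (simp add: carrier_S)

text \<open>The differential at 0 of left translation by \<open>x\<close> in N, read off from the
  joint multiplication so that its differentiability in \<open>x\<close> follows from smoothness in
  both variables.\<close>

definition B :: "real ^ 'k \<Rightarrow> real ^ 'k \<Rightarrow> real ^ 'k" where
  "B x v = frechet_derivative (\<lambda>(p, q). p \<otimes>\<^bsub>N\<^esub> q) (at (x, 0)) (0, v)"

lemma smooth_mult_N: "smooth_on UNIV (\<lambda>(p, q). p \<otimes>\<^bsub>N\<^esub> q)"
  using lie_group_N by (simp add: lie_group_def carrier_N)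

lemma has_derivative_mult_N: "((\<lambda>y. x \<otimes>\<^bsub>N\<^esub> y) has_derivative B x) (at 0)"
proof -
  have "Ck_on (Suc 0) UNIV (\<lambda>(p, q). p \<otimes>\<^bsub>N\<^esub> q)"
    using smooth_mult_N by (simp only: smooth_on_def)
  then have *: "((\<lambda>(p, q). p \<otimes>\<^bsub>N\<^esub> q) has_derivative
      frechet_derivative (\<lambda>(p, q). p \<otimes>\<^bsub>N\<^esub> q) (at (x, 0))) (at (x, 0))"
    by (intro has_derivative_frechet) auto
  have "((\<lambda>y. (x, y)) has_derivative (\<lambda>v. (0, v))) (at 0)"
    by (intro has_derivative_Pair has_derivative_const has_derivative_ident)
  from has_derivative_compose[OF this *] show ?thesis
    by (simp add: B_def[abs_def])
qed

lemma linear_B: "linear (B x)"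
  using has_derivative_mult_N by (rule has_derivative_linear)

lemma differentiable_B: "(\<lambda>x. B x v) differentiable (at x)"
proof -
  have "Ck_on (Suc (Suc 0)) UNIV (\<lambda>(p, q). p \<otimes>\<^bsub>N\<^esub> q)"
    using smooth_mult_N by (simp only: smooth_on_def)
  then have "(\<lambda>z. frechet_derivative (\<lambda>(p, q). p \<otimes>\<^bsub>N\<^esub> q) (at z) (0, v)) differentiable (at (x, 0))"
    by auto
  then show ?thesis
    unfolding B_def
    by (rule differentiable_compose)
       (rule differentiableI[OF has_derivative_Pair[OF has_derivative_ident has_derivative_const]])
qed

definition frame :: "'k option \<Rightarrow> 'k coords \<Rightarrow> 'k coords" where
  "frame c q = (case c of None \<Rightarrow> pt (t_of q) 0
     | Some k \<Rightarrow> t_of q powr lam (idx k) *\<^sub>R pt 0 (B (x_of q) (axis k 1)))"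

text \<open>The frame is left-invariant, so its orthonormality need only be checked at the identity.\<close>

lemma dL_frame:
  assumes "q \<in> carrier S"
  shows "dL S q \<one>\<^bsub>S\<^esub> (axis c 1) = frame c q"
proof -
  let ?t = "t_of q" and ?x = "x_of q"
  have t: "?t > 0" using assms by (simp add: carrier_S)
  have "bounded_linear (mu lam idx ?t)"
    by (rule linear_conv_bounded_linear[THEN iffD1])
       (auto simp: mu_def vec_eq_iff algebra_simps intro!: linearI)
  then have "((\<lambda>y. mu lam idx ?t (x_of y)) has_derivative (\<lambda>u. mu lam idx ?t (x_of u))) (at (pt 1 0))"
    using has_derivative_x_of by (rule bounded_linear.has_derivative)
  then have "((\<lambda>y. ?x \<otimes>\<^bsub>N\<^esub> mu lam idx ?t (x_of y)) has_derivative (\<lambda>u. B ?x (mu lam idx ?t (x_of u)))) (at (pt 1 0))"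
    by (rule has_derivative_compose) (simp add: has_derivative_mult_N)
  then have "((\<lambda>y. pt (?t * t_of y) (?x \<otimes>\<^bsub>N\<^esub> mu lam idx ?t (x_of y))) has_derivative
      (\<lambda>u. pt (?t * t_of u) (B ?x (mu lam idx ?t (x_of u))))) (at (pt 1 0))"
    by (intro has_derivative_pt has_derivative_mult_right has_derivative_t_of)
  then have "((\<lambda>y. q \<otimes>\<^bsub>S\<^esub> y) has_derivative
      (\<lambda>u. pt (?t * t_of u) (B ?x (mu lam idx ?t (x_of u))))) (at (pt 1 0))"
  \<comment> \<open>\<open>mult_S\<close> describes the product for positive t, so the derivative is
    transferred along the open carrier.\<close>
  proof (rule has_derivative_transform_within_open[OF _ open_carrier])
    show "pt 1 0 \<in> carrier S" by (simp add: carrier_S)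
    show "pt (?t * t_of y) (?x \<otimes>\<^bsub>N\<^esub> mu lam idx ?t (x_of y)) = q \<otimes>\<^bsub>S\<^esub> y" if "y \<in> carrier S" for y
      using mult_S[rule_format, of ?t "t_of y" ?x "x_of y"] t that by (simp add: carrier_S)
  qed
  then have "dL S q \<one>\<^bsub>S\<^esub> (axis c 1) = pt (?t * t_of (axis c 1)) (B ?x (mu lam idx ?t (x_of (axis c 1))))"
    by (simp add: dL_def one_S frechet_derivative_eq)
  also have "\<dots> = frame c q"
  proof (cases c)
    case None
    then show ?thesis by (simp add: frame_def linear_0[OF linear_B])
  next
    case (Some k)
    have "mu lam idx ?t (axis k 1) = ?t powr lam (idx k) *\<^sub>R axis k 1"
      by (simp add: mu_def vec_eq_iff axis_def)
    then show ?thesis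
      by (simp add: frame_def Some axis_Some_pt linear_scale[OF linear_B])
         (simp add: pt_def vec_eq_iff split: option.split)
  qed
  finally show ?thesis .
qed

lemma X_vec_in_n_alg: "X_vec k \<in> n_alg S"
proof -
  have "X_vec k \<in> span (X_vec ` {l. idx l = idx k})"
    by (intro span_base) auto
  also have "\<dots> = eigenspace_ad S A_vec (lam (idx k))"
    by (rule bspec[OF span_X_vec idx_in])
  finally show ?thesis by (simp add: eigenspace_ad_def)
qed

lemma riemannian: "riemannian_metric_on (carrier S) g"
  and left_inv: "p \<in> carrier S \<Longrightarrow> q \<in> carrier S \<Longrightarrow>
    g (p \<otimes>\<^bsub>S\<^esub> q) (dL S p q u) (dL S p q v) = g q u v"
  using type by (auto simp: iwasawa_type_def left_invariant_metric_def)

lemma one_in_carrier: "\<one>\<^bsub>S\<^esub> \<in> carrier S"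
  by (simp add: one_S carrier_S)

text \<open>\<open>A_vec\<close> is orthogonal to every \<open>X_vec k\<close> because it lies in
  the orthogonal complement of \<open>n_alg S\<close>, which contains them.\<close>

lemma orthonormal_one: "g \<one>\<^bsub>S\<^esub> (axis c 1) (axis d 1) = (if c = d then 1 else 0)"
proof -
  have A: "g \<one>\<^bsub>S\<^esub> A_vec A_vec = 1" "g \<one>\<^bsub>S\<^esub> A_vec (X_vec k) = 0"
    and X: "g \<one>\<^bsub>S\<^esub> (X_vec k) (X_vec l) = (if k = l then 1 else 0)" for k l
    using A_vec_unit A_vec_in_a_alg X_vec_in_n_alg X_vec_orthonormal by (simp_all add: a_alg_def)
  moreover have "g \<one>\<^bsub>S\<^esub> (X_vec k) A_vec = 0" for k
    using A(2) riemannian one_in_carrier by (simp add: riemannian_metric_on_def)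
  ultimately show ?thesis
    by (cases c; cases d) (simp_all flip: A_vec_def X_vec_def)
qed

lemma frame_orthonormal:
  assumes "q \<in> carrier S"
  shows "g q (frame c q) (frame d q) = (if c = d then 1 else 0)"
  using left_inv[OF assms one_in_carrier, of "axis c 1" "axis d 1"] assms
  by (simp add: dL_frame orthonormal_one monoid.r_one[OF group.is_monoid[OF group_S]])

lemma differentiable_frame:
  assumes "q \<in> carrier S"
  shows "(\<lambda>q. frame c q $ i) differentiable (at q)"
proof (cases c)
  case None
  have "(\<lambda>q. frame c q $ i) = (\<lambda>q. if i = None then t_of q else 0)"
    by (auto simp: frame_def None pt_def fun_eq_iff split: option.split)
  then show ?thesis
    using has_derivative_t_of differentiable_def by (cases "i = None") auto
next
  case (Some k)
  show ?thesis
  proof (cases i)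
    case None
    then show ?thesis by (simp add: frame_def Some pt_def)
  next
    case (Some l)
    have "(\<lambda>q. B (x_of q) (axis k 1)) differentiable (at q)"
      by (rule differentiable_compose[OF differentiable_B differentiableI[OF has_derivative_x_of]])
    then have "(\<lambda>q. B (x_of q) (axis k 1) $ l) differentiable (at q)"
      by (rule differentiable_bounded_linear[OF bounded_linear_vec_nth])
    moreover have "(\<lambda>q. t_of q powr lam (idx k)) differentiable (at q)"
    proof -
      have "((\<lambda>t. t powr lam (idx k)) has_real_derivative (lam (idx k) * t_of q powr (lam (idx k) - 1))) (at (t_of q))"
        using assms by (intro has_real_derivative_powr) (simp add: carrier_S)
      from has_derivative_t_of_compose[OF this] show ?thesis by (auto simp: differentiable_def)
    qed
    ultimately show ?thesis
      by (simp add: frame_def \<open>c = Some k\<close> Some pt_def)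
  qed
qed

sublocale orthonormal_frame "carrier S" g frame
  using riemannian
  by unfold_locales
     (auto simp: open_carrier frame_orthonormal differentiable_frame riemannian_metric_on_def)

section \<open>The t-direction of the Laplacian\<close>

lemma acoef_None: "acoef i None q = (if i = None then (t_of q)\<^sup>2 else 0)"
  \<comment> \<open>Only \<open>frame None\<close> has a t-component, and it has no
    x-component.\<close>
  by (auto simp: acoef_def sum_UNIV_option frame_def pt_nth power2_eq_square split: option.split)

text \<open>The frame at (t, x) is the one at (1, x) with rows scaled by t and by t^(\<lambda>_k).
  The determinant gains the product t^(1 + \<open>hdim\<close>) of these factors, and the density is
  its reciprocal in absolute value.\<close>

lemma vol_density_chart:
  assumes "q \<in> carrier S"
  shows "vol_density g q = vol_density g (pt 1 (x_of q)) * t_of q powr (- hdim - 1)"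
proof -
  let ?t = "t_of q" and ?q1 = "pt 1 (x_of q)"
  let ?s = "\<lambda>c. case c of None \<Rightarrow> ?t | Some k \<Rightarrow> ?t powr lam (idx k)"
  have t: "?t > 0" using assms by (simp add: carrier_S)
  have "frame c q = ?s c *s frame c ?q1" for c
    by (cases c) (auto simp: frame_def vec_eq_iff pt_nth split: option.split)
  then have "fmat q = (\<chi> c. ?s c *s frame c ?q1)"
    by (simp add: fmat_def)
  then have "det (fmat q) = (\<Prod>c\<in>UNIV. ?s c) * det (fmat ?q1)"
    by (simp add: det_rows_mul fmat_def)
  also have "(\<Prod>c\<in>UNIV. ?s c) = ?t powr (1 + hdim)"
    using t by (simp add: prod_UNIV_option powr_add hdim_def powr_sum)
  finally have "det (fmat q) = ?t powr (1 + hdim) * det (fmat ?q1)" .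
  moreover have "?t powr (- hdim - 1) = 1 / ?t powr (1 + hdim)"
  proof -
    have "- hdim - 1 = - (1 + hdim)" by simp
    then show ?thesis by (simp only: powr_minus_divide)
  qed
  ultimately show ?thesis
    using assms by (simp add: vol_density_frame carrier_S abs_mult)
qed

text \<open>Mixed entries of \<open>acoef\<close> vanish, so only the t-derivative of density times
  t^2 = \<delta>(x) t^(1 - \<open>hdim\<close>) contributes; \<delta>(x) cancels on division by the
  density.\<close>

lemma bcoef_None:
  assumes "p \<in> carrier S"
  shows "bcoef None p = (1 - hdim) * t_of p"
proof -
  let ?t = "t_of p"
  define \<delta> where "\<delta> x = vol_density g (pt 1 x)" for x
  have t: "?t > 0" using assms by (simp add: carrier_S)
  have "vol_density g differentiable (at (pt 1 (x_of p)))"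
    by (rule differentiable_vol_density) (simp add: carrier_S)
  moreover have "(\<lambda>q. pt 1 (x_of q)) differentiable (at p)"
    by (rule differentiableI[OF has_derivative_pt[OF has_derivative_const has_derivative_x_of]])
  ultimately have \<delta>: "(\<lambda>q. \<delta> (x_of q)) differentiable (at p)"
    unfolding \<delta>_def by (rule differentiable_compose[of "vol_density g" "\<lambda>q. pt 1 (x_of q)"])
  have "((\<lambda>t. t powr (1 - hdim)) has_real_derivative (1 - hdim) * ?t powr (1 - hdim - 1)) (at ?t)"
    using t by (intro has_real_derivative_powr)
  note pw = has_derivative_t_of_compose[OF this]
  have "pd None (\<lambda>q. vol_density g q * acoef None None q) p =
      pd None (\<lambda>q. \<delta> (x_of q) * t_of q powr (1 - hdim)) p"
  proof (rule pd_cong[OF open_carrier assms])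
    fix q assume q: "q \<in> carrier S"
    have "t_of q powr (- hdim - 1) * (t_of q)\<^sup>2 = t_of q powr (- hdim - 1 + 2)"
      using q by (subst powr_add) (simp add: carrier_S)
    also have "- hdim - 1 + 2 = 1 - hdim" by simp
    finally show "vol_density g q * acoef None None q = \<delta> (x_of q) * t_of q powr (1 - hdim)"
      by (simp add: acoef_None vol_density_chart[OF q] \<delta>_def)
  qed
  also have "\<dots> = \<delta> (x_of p) * ((1 - hdim) * ?t powr (- hdim))"
    by (simp add: pd_mult[OF \<delta> differentiableI[OF pw]] pd_None_x_of[OF \<delta>] pd_eq[OF pw])
  also have "\<dots> = vol_density g p * ((1 - hdim) * ?t)"
  proof -
    have "?t powr (- hdim) = ?t powr (- hdim - 1) * ?t"
      using t powr_add[of ?t "- hdim - 1" 1] by simp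
    then show ?thesis
      unfolding vol_density_chart[OF assms] \<delta>_def by (simp only: mult_ac)
  qed
  finally show ?thesis
    using vol_density_pos[OF assms] by (simp add: bcoef_def sum_UNIV_option acoef_None)
qed

text \<open>The gradients of \<open>u\<close> and \<open>F\<close> are orthogonal, as
  \<open>acoef\<close> has no mixed entries with t; hence the product rule leaves no cross
  term.\<close>

lemma tau_separated:
  fixes u u' u'' :: "real \<Rightarrow> real"
  assumes u: "\<And>t. t > 0 \<Longrightarrow> (u has_real_derivative u' t) (at t)"
    and u': "\<And>t. t > 0 \<Longrightarrow> (u' has_real_derivative u'' t) (at t)"
    and Ck_u: "Ck_on 2 (carrier S) (\<lambda>q. complex_of_real (u (t_of q)))"
    and Ck_F: "Ck_on 2 (carrier S) (F \<circ> x_of)"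
    and p: "p \<in> carrier S"
  shows "lapl (\<lambda>q. of_real (u (t_of q)) * F (x_of q)) p =
    of_real (u (t_of p)) * tau g (F \<circ> x_of) p +
    of_real ((t_of p)\<^sup>2 * u'' (t_of p) + (1 - hdim) * t_of p * u' (t_of p)) * F (x_of p)"
proof -
  let ?u = "\<lambda>q :: 'k coords. complex_of_real (u (t_of q))"
  have pd1: "pd None ?u q = of_real (u' (t_of q))" "pd (Some k) ?u q = 0" if "q \<in> carrier S" for q k
    using that by (simp_all add: carrier_S pd_eq[OF has_derivative_of_real_t_of[OF u]])
  have "pd None (pd None ?u) p = pd None (\<lambda>q. of_real (u' (t_of q))) p"
    by (rule pd_cong[OF open_carrier p pd1(1)])
  also have "\<dots> = of_real (u'' (t_of p))"
    using p by (simp add: carrier_S pd_eq[OF has_derivative_of_real_t_of[OF u']])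
  finally have pd2: "pd None (pd None ?u) p = of_real (u'' (t_of p))" .
  have pd3: "pd i (pd (Some k) ?u) p = 0" for i k
    using pd_cong[OF open_carrier p pd1(2)] by simp
  have a: "acoef None i q = (if i = None then (t_of q)\<^sup>2 else 0)" for i q
    using acoef_None acoef_commute by metis
  have lapl_u: "lapl ?u p = of_real ((t_of p)\<^sup>2 * u'' (t_of p) + (1 - hdim) * t_of p * u' (t_of p))"
    by (simp add: lapl_def sum_UNIV_option acoef_None a pd1 pd2 pd3 p bcoef_None)
  have F: "pd None (F \<circ> x_of) p = 0"
    using pd_None_x_of[of F p] Ck2D(1)[OF Ck_F p] by (simp add: comp_def)
  show ?thesis
    using lapl_mult[OF Ck_u Ck_F p] tau_frame[OF Ck_F p]
    by (simp add: lapl_u sum_UNIV_option F pd1 p a)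
qed

end

section \<open>The radial functions\<close>

text \<open>The complete homogeneous symmetric polynomial of degree \<open>j\<close> in \<open>1 / D 1, \<dots>, 1 / D i\<close>, multiplied by
  the product of these \<open>i\<close> numbers.\<close>

definition chs :: "(nat \<Rightarrow> real) \<Rightarrow> nat \<Rightarrow> nat \<Rightarrow> real" where
  "chs D i j = (\<Sum>ls | length ls = i \<and> sum_list ls = j. \<Prod>k=1..i. (1 / D k) ^ (ls ! (k - 1) + 1))"

lemma finite_compositions: "finite {ls :: nat list. length ls = i \<and> sum_list ls = j}"
proof (rule finite_subset)
  show "{ls. length ls = i \<and> sum_list ls = j} \<subseteq> {ls. set ls \<subseteq> {..j} \<and> length ls = i}"
    using member_le_sum_list by auto
  show "finite {ls. set ls \<subseteq> {..j} \<and> length ls = i}"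
    by (rule finite_lists_length_eq) simp
qed

lemma chs_0: "chs D 0 j = (if j = 0 then 1 else 0)"
proof -
  have "{ls :: nat list. length ls = 0 \<and> sum_list ls = j} = (if j = 0 then {[]} else {})" by auto
  then show ?thesis by (simp add: chs_def)
qed

text \<open>The last entry l of each exponent list is split off.\<close>

lemma chs_Suc: "chs D (Suc i) j = (\<Sum>l\<le>j. chs D i (j - l) * (1 / D (Suc i)) ^ (l + 1))"
proof -
  let ?W = "\<lambda>i ls. \<Prod>k=1..i. (1 / D k) ^ (ls ! (k - 1) + 1)"
  let ?L = "\<lambda>i j. {ls :: nat list. length ls = i \<and> sum_list ls = j}"
  have W: "?W (Suc i) (ls @ [l]) = ?W i ls * (1 / D (Suc i)) ^ (l + 1)" if "length ls = i" for ls l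
  proof -
    have "?W i (ls @ [l]) = ?W i ls"
      by (rule prod.cong) (use that in \<open>auto simp: nth_append\<close>)
    then show ?thesis
      using that by (simp add: prod.nat_ivl_Suc' nth_append mult.commute)
  qed
  have "(\<Sum>l\<le>j. chs D i (j - l) * (1 / D (Suc i)) ^ (l + 1)) =
      (\<Sum>l\<le>j. \<Sum>ls\<in>?L i (j - l). ?W (Suc i) (ls @ [l]))"
    unfolding chs_def sum_distrib_right by (intro sum.cong refl, rule W[symmetric], simp)
  also have "\<dots> = (\<Sum>(l, ls)\<in>Sigma {..j} (\<lambda>l. ?L i (j - l)). ?W (Suc i) (ls @ [l]))"
    by (rule sum.Sigma) (auto simp: finite_compositions)
  also have "\<dots> = sum (?W (Suc i)) (?L (Suc i) j)"
  proof (rule sum.reindex_bij_witness[where j = "\<lambda>(l, ls). ls @ [l]" and i = "\<lambda>ls. (last ls, butlast ls)"])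
    fix ls :: "nat list" assume ls: "ls \<in> ?L (Suc i) j"
    then have "ls \<noteq> []" by auto
    then have "butlast ls @ [last ls] = ls" by simp
    moreover from this have "sum_list (butlast ls) + last ls = j"
      using ls by (metis (mono_tags, lifting) add_0_right mem_Collect_eq sum_list.Cons sum_list.Nil sum_list.append)
    ultimately show "(case (last ls, butlast ls) of (l, ls) \<Rightarrow> ls @ [l]) = ls"
      and "(last ls, butlast ls) \<in> Sigma {..j} (\<lambda>l. ?L i (j - l))"
      using ls by auto
  qed auto
  finally show ?thesis by (simp add: chs_def)
qed

text \<open>With W_i(z) the generating function of \<open>chs D i\<close>, formally the product of 1
  / (D k - z) over k \<le> i, this is the coefficient of z^j in (D (i+1) - z) W_(i+1) = W_i.\<close>

lemma chs_step:
  assumes "D (Suc i) \<noteq> 0"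
  shows "D (Suc i) * chs D (Suc i) j = chs D i j + (if j = 0 then 0 else chs D (Suc i) (j - 1))"
proof (cases j)
  case 0
  then show ?thesis using assms by (simp add: chs_Suc)
next
  case (Suc j')
  let ?x = "1 / D (Suc i)"
  have "D (Suc i) * chs D (Suc i) j = (\<Sum>l\<le>Suc j'. chs D i (Suc j' - l) * ?x ^ l)"
    using assms by (simp add: chs_Suc Suc sum_distrib_left field_simps del: sum.atMost_Suc)
  also have "\<dots> = chs D i j + chs D (Suc i) j'"
    by (simp only: sum.atMost_Suc_shift) (simp add: chs_Suc Suc)
  finally show ?thesis by (simp add: Suc)
qed

lemma chs_cong: "(\<And>k. k \<in> {1..i} \<Longrightarrow> D k = D' k) \<Longrightarrow> chs D i j = chs D' i j"
  unfolding chs_def by (intro sum.cong prod.cong refl) auto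

section \<open>Appell polynomials\<close>

definition ffact :: "nat \<Rightarrow> nat \<Rightarrow> real" where
  "ffact q j = (\<Prod>k=1..j. real (Suc q) - real k)"

lemma ffact_0 [simp]: "ffact q 0 = 1"
  by (simp add: ffact_def)

lemma ffact_Suc: "ffact q (Suc j) = ffact q j * (real q - real j)"
  by (simp add: ffact_def prod.nat_ivl_Suc' mult.commute)

lemma ffact_Suc': "ffact q (Suc j) = real q * ffact (q - 1) j"
proof (cases q)
  case 0
  then show ?thesis by (induction j) (simp_all add: ffact_Suc)
next
  case (Suc q')
  then show ?thesis by (induction j) (simp_all add: ffact_Suc)
qed

text \<open>This is q! times the coefficient of z^q in (sum of C_j z^j) exp(s z). Multiplying that
  series by z replaces \<open>appell C q\<close> by
  \<open>real q * appell C (q - 1)\<close>.\<close>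

definition appell :: "(nat \<Rightarrow> real) \<Rightarrow> nat \<Rightarrow> real \<Rightarrow> real" where
  "appell C q s = (\<Sum>j\<le>q. C j * ffact q j * s ^ (q - j))"

lemma appell_0: "appell C 0 s = C 0"
  by (simp add: appell_def)

text \<open>Serves both the derivative in s and the shift of the coefficient sequence, each of which
  multiplies the generating series by z.\<close>

lemma appell_shift:
  "(\<Sum>j<q. C j * ffact q (Suc j) * s ^ (q - Suc j)) = real q * appell C (q - 1) s"
proof (cases q)
  case (Suc q')
  then show ?thesis
    by (simp only: lessThan_Suc_atMost appell_def ffact_Suc')
       (simp add: sum_distrib_left mult_ac)
qed simp

lemma appell_deriv: "(appell C q has_real_derivative real q * appell C (q - 1) s) (at s)"
proof -
  have "((\<lambda>s. \<Sum>j\<le>q. C j * ffact q j * s ^ (q - j)) has_real_derivative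
      (\<Sum>j\<le>q. C j * ffact q j * (real (q - j) * s ^ (q - j - 1)))) (at s)"
    by (intro DERIV_sum DERIV_cmult) (unfold One_nat_def, rule DERIV_pow)
  \<comment> \<open>The summand j = q drops out through its factor q - j; there the truncated
    exponent has no meaning.\<close>
  also have "(\<Sum>j\<le>q. C j * ffact q j * (real (q - j) * s ^ (q - j - 1))) =
      (\<Sum>j<q. C j * ffact q j * (real (q - j) * s ^ (q - j - 1)))"
    by (simp flip: lessThan_Suc_atMost)
  also have "\<dots> = (\<Sum>j<q. C j * ffact q (Suc j) * s ^ (q - Suc j))"
    by (intro sum.cong refl) (simp add: ffact_Suc of_nat_diff)
  finally show ?thesis
    by (simp add: appell_shift appell_def[abs_def])
qed

lemma appell_recurrence:
  assumes "\<And>j. K * C j = - C1 j - M * (if j = 0 then 0 else C (j - 1))"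
  shows "K * appell C q s = - appell C1 q s - M * (real q * appell C (q - 1) s)"
proof -
  have "K * appell C q s = (\<Sum>j\<le>q. (K * C j) * ffact q j * s ^ (q - j))"
    by (simp add: appell_def sum_distrib_left mult.assoc)
  also have "\<dots> = - appell C1 q s - M * (\<Sum>j\<le>q. (if j = 0 then 0 else C (j - 1)) * ffact q j * s ^ (q - j))"
    unfolding assms
    by (simp add: appell_def sum_distrib_left ring_distribs sum_subtractf sum_negf mult.assoc)
  also have "(\<Sum>j\<le>q. (if j = 0 then 0 else C (j - 1)) * ffact q j * s ^ (q - j)) = real q * appell C (q - 1) s"
    by (simp add: sum.atMost_shift appell_shift)
  finally show ?thesis .
qed

section \<open>Powers of t times polynomials in log t\<close>

definition plog :: "(nat \<Rightarrow> real) \<Rightarrow> real \<Rightarrow> nat \<Rightarrow> real \<Rightarrow> real" where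
  "plog C c q t = t powr c * appell C q (ln t)"

text \<open>Differentiation stays within the family with the same \<open>C\<close>, which gives
  second derivatives by iteration and smoothness by induction.\<close>

lemma plog_deriv:
  assumes "t > 0"
  shows "(plog C c q has_real_derivative c * plog C (c - 1) q t + real q * plog C (c - 1) (q - 1) t) (at t)"
proof -
  have "((\<lambda>t. appell C q (ln t)) has_real_derivative (real q * appell C (q - 1) (ln t)) * inverse t) (at t)"
    by (rule DERIV_chain2[OF appell_deriv DERIV_ln[OF assms]])
  from DERIV_mult[OF has_real_derivative_powr[OF assms, of c] this]
  have "(plog C c q has_real_derivative c * t powr (c - 1) * appell C q (ln t) +
      real q * appell C (q - 1) (ln t) * inverse t * t powr c) (at t)"
    by (simp add: plog_def[abs_def])
  moreover have "real q * appell C (q - 1) (ln t) * inverse t * t powr c =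
      real q * (t powr (c - 1) * appell C (q - 1) (ln t))"
    using assms powr_diff[of t c 1] by (simp add: field_simps)
  ultimately show ?thesis
    by (simp only: plog_def mult.assoc)
qed

lemma plog_mult_powr: "t powr a * plog C c q t = plog C (a + c) q t"
  by (simp add: plog_def powr_add)

text \<open>Conjugating the operator by \<open>t powr \<sigma>\<close> with \<open>\<sigma> = (n - \<nu>) / 2\<close> and \<open>\<nu> = \<plusminus>n\<close> exchanges the parameters
  \<open>n\<close> and \<open>\<nu>\<close>; thereby the two families \<open>f\<close> and \<open>g\<close> become the cases \<open>\<nu> = n\<close> and \<open>\<nu> = -n\<close> of one.\<close>

lemma plog_operator:
  fixes C :: "nat \<Rightarrow> real" and q :: nat
  assumes "t > 0" and \<nu>: "\<nu>\<^sup>2 = n\<^sup>2" and c: "c = (n - \<nu>) / 2 + 2 * L"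
  defines "u' \<equiv> \<lambda>t. c * plog C (c - 1) q t + real q * plog C (c - 1) (q - 1) t"
    and "u'' \<equiv> \<lambda>t. c * ((c - 1) * plog C (c - 1 - 1) q t + real q * plog C (c - 1 - 1) (q - 1) t) +
           real q * ((c - 1) * plog C (c - 1 - 1) (q - 1) t + real (q - 1) * plog C (c - 1 - 1) (q - 1 - 1) t)"
  shows "t\<^sup>2 * u'' t + (1 - n) * t * u' t =
     2 * L * (2 * L - \<nu>) * plog C c q t + 4 * L * (real q * plog C c (q - 1) t) +
     (real q * (real (q - 1) * plog C c (q - 2) t) - \<nu> * (real q * plog C c (q - 1) t))"
proof -
  have 1: "t * plog C (c - 1) q t = plog C c q t" for q
    using plog_mult_powr[of t 1 C "c - 1" q] assms(1) by simp
  have 2: "t\<^sup>2 * plog C (c - 1 - 1) q t = plog C c q t" for q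
    using plog_mult_powr[of t 2 C "c - 1 - 1" q] assms(1) by simp
  have "t\<^sup>2 * u'' t = c * ((c - 1) * plog C c q t + real q * plog C c (q - 1) t) +
     real q * ((c - 1) * plog C c (q - 1) t + real (q - 1) * plog C c (q - 2) t)"
  proof -
    have "t\<^sup>2 * u'' t = c * ((c - 1) * (t\<^sup>2 * plog C (c - 1 - 1) q t) + real q * (t\<^sup>2 * plog C (c - 1 - 1) (q - 1) t)) +
     real q * ((c - 1) * (t\<^sup>2 * plog C (c - 1 - 1) (q - 1) t) + real (q - 1) * (t\<^sup>2 * plog C (c - 1 - 1) (q - 1 - 1) t))"
      unfolding u''_def by (simp only: ring_distribs mult_ac)
    then show ?thesis by (simp only: 2) (simp add: numeral_2_eq_2)
  qed
  moreover have "(1 - n) * t * u' t = (1 - n) * (c * plog C c q t + real q * plog C c (q - 1) t)"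
  proof -
    have "(1 - n) * t * u' t = (1 - n) * (c * (t * plog C (c - 1) q t) + real q * (t * plog C (c - 1) (q - 1) t))"
      unfolding u'_def by (simp only: ring_distribs mult_ac)
    then show ?thesis by (simp only: 1)
  qed
  \<comment> \<open>Here \<nu>^2 = n^2 enters: c (c - n) = (2 L - \<nu>/2)^2 - n^2/4.\<close>
  moreover have "c * (c - n) = 2 * L * (2 * L - \<nu>)" "2 * c - n = 4 * L - \<nu>"
    using \<nu> by (auto simp: c field_simps power2_eq_square)
  \<comment> \<open>On t^(c + z) the operator acts as (c + z)(c + z - n); its coefficients of 1, z
    and z^2 go with lowering q by 0, 1 and 2.\<close>
  ultimately have "t\<^sup>2 * u'' t + (1 - n) * t * u' t = (c * (c - n)) * plog C c q t +
      (2 * c - n) * (real q * plog C c (q - 1) t) + real q * (real (q - 1) * plog C c (q - 2) t)"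
    by (simp add: algebra_simps)
  then show ?thesis
    unfolding \<open>c * (c - n) = _\<close> \<open>2 * c - n = _\<close> by (simp add: algebra_simps)
qed

text \<open>Formally the coefficient of z^j in the product over k of -1 / (2 \<Lambda>_k (2
  \<Lambda>_k - \<nu> + 2 z)), where \<Lambda>_k = \<open>Lam lam \<alpha> k\<close>.\<close>

definition tcoef :: "(nat \<Rightarrow> real) \<Rightarrow> real \<Rightarrow> nat list \<Rightarrow> nat \<Rightarrow> real" where
  "tcoef lam \<nu> \<alpha> j = (- 1) ^ (length \<alpha> + j) * 2 powi (int j - int (length \<alpha>)) *
     chs (\<lambda>k. 2 * Lam lam \<alpha> k - \<nu>) (length \<alpha>) j / (\<Prod>k=1..length \<alpha>. Lam lam \<alpha> k)"

lemma Lam_append: "k \<le> length \<beta> \<Longrightarrow> Lam lam (\<beta> @ \<gamma>) k = Lam lam \<beta> k"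
  unfolding Lam_def by (rule sum.cong) (auto simp: nth_append)

lemma Lam_snoc: "Lam lam (\<beta> @ [l]) (Suc (length \<beta>)) = Lam lam \<beta> (length \<beta>) + lam l"
  using Lam_append[of "length \<beta>" \<beta> lam "[l]"] by (simp add: Lam_def)

lemma tcoef_Nil: "tcoef lam \<nu> [] j = (if j = 0 then 1 else 0)"
  by (simp add: tcoef_def chs_0)

text \<open>Writing T for the generating function of \<open>tcoef\<close>, this is 2 L (2 L - \<nu>
  + 2 z) T_(\<beta>l) = - T_\<beta> in coefficients; it is \<open>chs_step\<close> with -2 z in
  place of z.\<close>

lemma tcoef_snoc:
  fixes lam :: "nat \<Rightarrow> real" and \<beta> :: "nat list" and l :: nat
  defines "L \<equiv> Lam lam (\<beta> @ [l]) (Suc (length \<beta>))"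
  assumes L: "L \<noteq> 0" and d: "2 * L - \<nu> \<noteq> 0"
  shows "2 * L * (2 * L - \<nu>) * tcoef lam \<nu> (\<beta> @ [l]) j =
    - tcoef lam \<nu> \<beta> j - 4 * L * (if j = 0 then 0 else tcoef lam \<nu> (\<beta> @ [l]) (j - 1))"
proof -
  let ?i = "length \<beta>"
  let ?D = "\<lambda>k. 2 * Lam lam (\<beta> @ [l]) k - \<nu>"
  let ?w = "chs ?D (Suc ?i)" and ?v = "chs ?D ?i"
  define P where "P = (\<Prod>k=1..?i. Lam lam \<beta> k)"
  have P: "(\<Prod>k=1..Suc ?i. Lam lam (\<beta> @ [l]) k) = L * P"
    by (simp add: prod.nat_ivl_Suc' L_def P_def Lam_append)
  have w0: "chs (\<lambda>k. 2 * Lam lam \<beta> k - \<nu>) ?i j = ?v j" for j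
    by (rule chs_cong) (simp add: Lam_append)
  have step: "(2 * L - \<nu>) * ?w j = ?v j + (if j = 0 then 0 else ?w (j - 1))"
    using chs_step[of ?D ?i j] d unfolding L_def by blast
  have pw: "2 * 2 powi (int j - int (Suc ?i)) = (2 powi (int j - int ?i) :: real)" for j
    using power_int_add_1[of "2 :: real" "int j - int (Suc ?i)"] by (simp add: algebra_simps)
  \<comment> \<open>The common sign and power of two: a further letter of the index contributes
    -1/2, and raising j by one contributes -2.\<close>
  define s where "s j = (- 1) ^ (?i + j) * (2 powi (int j - int ?i) :: real)" for j
  have c0: "tcoef lam \<nu> \<beta> j = s j * ?v j / P" for j
    by (simp add: tcoef_def w0 s_def P_def)
  have c1: "2 * L * tcoef lam \<nu> (\<beta> @ [l]) j = - s j * ?w j / P" for j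
  proof -
    have "tcoef lam \<nu> (\<beta> @ [l]) j = - ((- 1) ^ (?i + j)) * 2 powi (int j - int (Suc ?i)) * ?w j / (L * P)"
      using P by (simp add: tcoef_def)
    then have "2 * L * tcoef lam \<nu> (\<beta> @ [l]) j =
        - ((- 1) ^ (?i + j)) * (2 * 2 powi (int j - int (Suc ?i))) * ?w j / P"
      using L by simp
    then show ?thesis by (simp only: pw s_def) simp
  qed
  have s: "s j = - 2 * s (j - 1)" if "j \<noteq> 0"
  proof -
    obtain j' where j: "j = Suc j'" using \<open>j \<noteq> 0\<close> not0_implies_Suc by blast
    have "(2 :: real) powi (int j - int ?i) = 2 * 2 powi (int j' - int ?i)"
      using power_int_add_1[of "2 :: real" "int j' - int ?i"] by (simp add: j algebra_simps)
    then show ?thesis by (simp add: s_def j)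
  qed
  have "2 * L * (2 * L - \<nu>) * tcoef lam \<nu> (\<beta> @ [l]) j = (2 * L - \<nu>) * (2 * L * tcoef lam \<nu> (\<beta> @ [l]) j)"
    by simp
  also have "\<dots> = - s j * ((2 * L - \<nu>) * ?w j) / P"
    by (simp only: c1) simp
  also have "\<dots> = - s j * ?v j / P - s j * (if j = 0 then 0 else ?w (j - 1)) / P"
    by (simp only: step) (simp add: algebra_simps add_divide_distrib diff_divide_distrib)
  also have "\<dots> = - tcoef lam \<nu> \<beta> j - 4 * L * (if j = 0 then 0 else tcoef lam \<nu> (\<beta> @ [l]) (j - 1))"
  proof (cases "j = 0")
    case False
    have "- s j * ?w (j - 1) / P = 2 * (s (j - 1) * ?w (j - 1) / P)"
      by (simp add: s[OF False])
    also have "\<dots> = - 2 * (2 * L * tcoef lam \<nu> (\<beta> @ [l]) (j - 1))"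
      by (simp only: c1)
    finally show ?thesis using False by (simp add: c0)
  qed (simp add: c0)
  finally show ?thesis .
qed

text \<open>The sum over exponent lists is \<open>chs\<close> and the product of the p - k is
  \<open>ffact\<close>. The parameter \<nu> is arbitrary, so that -n gives the functions
  \<open>g_fun\<close>.\<close>

lemma f_fun_plog:
  "f_fun lam \<nu> \<alpha> t (Suc q) = plog (tcoef lam \<nu> \<alpha>) (2 * Lam lam \<alpha> (length \<alpha>)) q t"
proof -
  let ?i = "length \<alpha>" and ?P = "\<Prod>k=1..length \<alpha>. Lam lam \<alpha> k"
  let ?D = "\<lambda>k. 2 * Lam lam \<alpha> k - \<nu>"
  let ?s = "\<lambda>j. (- 1) ^ (?i + j) * 2 powi (int j - int ?i) :: real"
  have "(\<Sum>ls | length ls = ?i \<and> sum_list ls = j.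
        ?s j * (\<Prod>k=1..j. real (Suc q) - real k) /
        (\<Prod>k=1..?i. ?D k ^ (ls ! (k - 1) + 1)) * ln t ^ (Suc q - j - 1)) =
      ?s j * chs ?D ?i j * ffact q j * ln t ^ (q - j)" for j
  proof -
    have "?s j * (\<Prod>k=1..j. real (Suc q) - real k) /
        (\<Prod>k=1..?i. ?D k ^ (ls ! (k - 1) + 1)) * ln t ^ (Suc q - j - 1) =
      ?s j * ffact q j * ln t ^ (q - j) * (\<Prod>k=1..?i. (1 / ?D k) ^ (ls ! (k - 1) + 1))" for ls :: "nat list"
      by (simp add: ffact_def power_divide prod_dividef)
    then show ?thesis
      by (simp add: chs_def sum_distrib_left mult_ac)
  qed
  moreover have "?s j * chs ?D ?i j * ffact q j * ln t ^ (q - j) / ?P = tcoef lam \<nu> \<alpha> j * ffact q j * ln t ^ (q - j)" for j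
    by (simp add: tcoef_def)
  then have "(\<Sum>j\<le>q. ?s j * chs ?D ?i j * ffact q j * ln t ^ (q - j)) / ?P = appell (tcoef lam \<nu> \<alpha>) q (ln t)"
    by (simp only: sum_divide_distrib appell_def)
  ultimately show ?thesis
    unfolding f_fun_def Let_def plog_def
    by (simp only: atLeast0AtMost diff_Suc_1 times_divide_eq_left) (simp only: times_divide_eq_right[symmetric])
qed

lemma g_fun_f_fun: "g_fun lam n \<alpha> t p = t powr n * f_fun lam (- n) \<alpha> t p"
  by (simp add: g_fun_def f_fun_def Let_def powr_add)

section \<open>Tension trees and proper p-harmonic functions\<close>

text \<open>Locality of \<open>tau\<close>, for iterating it: the iterates are known in closed form
  on the carrier only.\<close>

lemma tau_cong:
  assumes U: "open U" "p \<in> U" and eq: "\<And>q. q \<in> U \<Longrightarrow> \<phi> q = \<phi>' q"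
  shows "tau g \<phi> p = tau g \<phi>' p"
proof -
  have *: "divergence g (grad g (\<lambda>q. T (\<phi> q))) p = divergence g (grad g (\<lambda>q. T (\<phi>' q))) p"
    for T :: "complex \<Rightarrow> real"
  proof -
    have "grad g (\<lambda>q. T (\<phi> q)) q = grad g (\<lambda>q. T (\<phi>' q)) q" if "q \<in> U" for q
      unfolding grad_def using frechet_derivative_cong_open[OF U(1) that, of "\<lambda>q. T (\<phi> q)" "\<lambda>q. T (\<phi>' q)"] eq
      by simp
    then have "frechet_derivative (\<lambda>q. vol_density g q * grad g (\<lambda>q. T (\<phi> q)) q $ i) (at p) =
        frechet_derivative (\<lambda>q. vol_density g q * grad g (\<lambda>q. T (\<phi>' q)) q $ i) (at p)" for i
      by (intro frechet_derivative_cong_open[OF U]) simp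
    then show ?thesis by (simp add: divergence_def)
  qed
  show ?thesis
    unfolding tau_def using *[of Re] *[of Im] by simp
qed

text \<open>The factor i kills the summand i = 0, where i - 1 is truncated; the vanishing of
  \<open>c (Suc K)\<close> closes the upper end.\<close>

lemma sum_shift:
  fixes c :: "nat \<Rightarrow> complex"
  assumes "c (Suc K) = 0"
  shows "(\<Sum>i\<le>K. c i * (of_nat i * F (i - 1))) = (\<Sum>i\<le>K. c (Suc i) * of_nat (Suc i) * F i)"
proof -
  have "(\<Sum>i\<le>K. c i * (of_nat i * F (i - 1))) = (\<Sum>i<K. c (Suc i) * of_nat (Suc i) * F i)"
    by (subst sum.atMost_shift) (simp add: mult.assoc)
  also have "\<dots> = (\<Sum>i\<le>K. c (Suc i) * of_nat (Suc i) * F i)"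
    using assms by (simp flip: lessThan_Suc_atMost)
  finally show ?thesis .
qed

lemma sum_multi_idx_Suc:
  "(\<Sum>\<alpha>\<in>multi_idx m (Suc i). F \<alpha>) = (\<Sum>\<beta>\<in>multi_idx m i. \<Sum>k=1..m. F (\<beta> @ [k]))"
proof -
  have "(\<Sum>\<beta>\<in>multi_idx m i. \<Sum>k=1..m. F (\<beta> @ [k])) = (\<Sum>(\<beta>, k)\<in>multi_idx m i \<times> {1..m}. F (\<beta> @ [k]))"
    by (rule sum.cartesian_product)
  also have "\<dots> = (\<Sum>\<alpha>\<in>multi_idx m (Suc i). F \<alpha>)"
  proof (rule sum.reindex_bij_witness[where j = "\<lambda>(\<beta>, k). \<beta> @ [k]" and i = "\<lambda>\<alpha>. (butlast \<alpha>, last \<alpha>)"])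
    fix \<alpha> assume \<alpha>: "\<alpha> \<in> multi_idx m (Suc i)"
    then have "\<alpha> \<noteq> []" by (auto simp: multi_idx_def)
    then have "last \<alpha> \<in> {1..m}"
      using \<alpha> subsetD[OF _ last_in_set, of \<alpha>] unfolding multi_idx_def by blast
    with \<open>\<alpha> \<noteq> []\<close> show "(case (butlast \<alpha>, last \<alpha>) of (\<beta>, k) \<Rightarrow> \<beta> @ [k]) = \<alpha>"
      and "(butlast \<alpha>, last \<alpha>) \<in> multi_idx m i \<times> {1..m}"
      using \<alpha> by (auto simp: multi_idx_def dest!: in_set_butlastD)
  qed (auto simp: multi_idx_def)
  finally show ?thesis by (rule sym)
qed

lemma multi_idx_0: "multi_idx m 0 = {[]}"
  by (auto simp: multi_idx_def)

lemma finite_multi_idx: "finite (multi_idx m i)"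
  unfolding multi_idx_def using finite_lists_length_eq[of "{1..m}" i] by (simp add: conj_commute)

lemma multi_idx_nth: "\<alpha> \<in> multi_idx m i \<Longrightarrow> j < i \<Longrightarrow> \<alpha> ! j \<in> {1..m}"
  unfolding multi_idx_def by (blast dest: subsetD[OF _ nth_mem])

text \<open>The limit \<open>t \<rightarrow> 0\<close> isolates the term of least exponent.\<close>

lemma leading_coeff_zero:
  fixes k :: "'s \<Rightarrow> complex"
  assumes fin: "finite J" and s0: "s0 \<in> J"
    and least: "\<And>s. s \<in> J \<Longrightarrow> s \<noteq> s0 \<Longrightarrow> \<epsilon> s0 < \<epsilon> s"
    and zero: "\<And>t. t > 0 \<Longrightarrow> (\<Sum>s\<in>J. of_real (t powr \<epsilon> s) * k s) = 0"
  shows "k s0 = 0"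
proof -
  have pos: "eventually (\<lambda>t :: real. t > 0) (at_right 0)"
    by (rule eventually_at_right_less)
  \<comment> \<open>After division by the power of least exponent all other terms carry positive
    powers of t.\<close>
  have lim: "((\<lambda>t. complex_of_real (t powr (\<epsilon> s - \<epsilon> s0)) * k s) \<longlongrightarrow> (if s = s0 then k s else 0)) (at_right 0)"
    if "s \<in> J" for s
  proof (cases "s = s0")
    case True
    have "eventually (\<lambda>t. k s = complex_of_real (t powr (\<epsilon> s - \<epsilon> s0)) * k s) (at_right 0)"
      using pos by eventually_elim (simp add: True)
    then show ?thesis
      using True by (auto intro: Lim_transform_eventually[OF tendsto_const])
  next
    case False
    have "((\<lambda>t :: real. t powr (\<epsilon> s - \<epsilon> s0)) \<longlongrightarrow> 0 powr (\<epsilon> s - \<epsilon> s0)) (at_right 0)"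
      using least[OF that False] pos
      by (intro tendsto_powr') (auto intro: tendsto_ident_at elim!: eventually_mono)
    then have "((\<lambda>t. complex_of_real (t powr (\<epsilon> s - \<epsilon> s0)) * k s) \<longlongrightarrow> of_real 0 * k s) (at_right 0)"
      by (intro tendsto_intros) simp
    then show ?thesis using False by simp
  qed
  have "((\<lambda>t. \<Sum>s\<in>J. complex_of_real (t powr (\<epsilon> s - \<epsilon> s0)) * k s) \<longlongrightarrow> (\<Sum>s\<in>J. if s = s0 then k s else 0)) (at_right 0)"
    by (rule tendsto_sum) (rule lim)
  moreover have "eventually (\<lambda>t. (\<Sum>s\<in>J. complex_of_real (t powr (\<epsilon> s - \<epsilon> s0)) * k s) = 0) (at_right 0)"
    using pos
  proof eventually_elim
    case (elim t)
    have "(\<Sum>s\<in>J. complex_of_real (t powr (\<epsilon> s - \<epsilon> s0)) * k s) =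
        (\<Sum>s\<in>J. of_real (t powr \<epsilon> s) * k s) / of_real (t powr \<epsilon> s0)"
      by (simp add: powr_diff sum_divide_distrib)
    then show ?case using zero[OF elim] by simp
  qed
  then have "((\<lambda>t. \<Sum>s\<in>J. complex_of_real (t powr (\<epsilon> s - \<epsilon> s0)) * k s) \<longlongrightarrow> 0) (at_right 0)"
    by (rule tendsto_eventually)
  ultimately have "(\<Sum>s\<in>J. if s = s0 then k s else 0) = 0"
    by (rule tendsto_unique[rotated]) simp
  then show ?thesis using fin s0 by simp
qed

section \<open>Eigenvalues, multiplicities and smooth radial factors\<close>

context iwasawa_chart
begin

text \<open>Positive definiteness of ad(A) is evaluated at an eigenvector.\<close>

lemma lam_pos:
  assumes "i \<in> {1..m}"
  shows "lam i > 0"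
proof -
  have "lam i \<in> lam ` {1..m}" using assms by (rule imageI)
  then obtain X where X: "X \<in> n_alg S" "X \<noteq> 0" "lie_bracket S A_vec X = lam i *\<^sub>R X"
    unfolding lam_eigenvalues by blast
  have "g \<one>\<^bsub>S\<^esub> (lie_bracket S A_vec X) X > 0"
    using ad_pos_def_A X unfolding ad_pos_def_def by blast
  then have "lam i * g \<one>\<^bsub>S\<^esub> X X > 0"
    using bilinear_lmul[OF bilinear_g[OF one_in_carrier]] X(3) by simp
  moreover have "g \<one>\<^bsub>S\<^esub> X X > 0"
    using riemannian one_in_carrier X(2) by (simp add: riemannian_metric_on_def)
  ultimately show ?thesis by (simp add: zero_less_mult_iff)
qed

lemma hdim_pos: "hdim > 0"
  unfolding hdim_def by (rule sum_pos) (rule finite, rule UNIV_not_empty, rule lam_pos[OF idx_in])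

lemma dim_eigenspace:
  assumes "i \<in> {1..m}"
  shows "dim (eigenspace_ad S A_vec (lam i)) = card {k. idx k = i}"
proof -
  have inj: "inj (X_vec :: 'k \<Rightarrow> 'k coords)"
    by (rule injI) (simp add: X_vec_def axis_eq_axis)
  have "X_vec ` {k. idx k = i} \<subseteq> (Basis :: 'k coords set)"
    by (auto simp: X_vec_def Basis_vec_def)
  then have "independent (X_vec ` {k. idx k = i} :: 'k coords set)"
    using independent_Basis independent_mono by blast
  then have "dim (span (X_vec ` {k. idx k = i} :: 'k coords set)) = card (X_vec ` {k. idx k = i} :: 'k coords set)"
    unfolding dim_span by (rule dim_eq_card_independent)
  also have "\<dots> = card {k. idx k = i}"
    by (rule card_image) (rule inj_on_subset[OF inj subset_UNIV])
  finally show ?thesis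
    by (simp only: bspec[OF span_X_vec assms])
qed

lemma hdim_eq: "(\<Sum>i=1..m. real (dim (eigenspace_ad S A_vec (lam i))) * lam i) = hdim"
proof -
  have "(\<Sum>i=1..m. real (dim (eigenspace_ad S A_vec (lam i))) * lam i) = (\<Sum>i=1..m. \<Sum>k\<in>{k \<in> UNIV. idx k = i}. lam (idx k))"
    by (rule sum.cong) (simp_all add: dim_eigenspace)
  also have "\<dots> = hdim"
    unfolding hdim_def by (rule sum.group) (use range_idx in auto)
  finally show ?thesis .
qed

text \<open>The induction runs over all \<open>c\<close> and \<open>q\<close> at once, since a
  derivative lowers both.\<close>

lemma smooth_plog: "smooth_on (carrier S) (\<lambda>p. complex_of_real (plog C c q (t_of p)))"
proof -
  have d: "((\<lambda>p. complex_of_real (plog C c q (t_of p))) has_derivative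
      (\<lambda>v. of_real (t_of v * (c * plog C (c - 1) q (t_of p) + real q * plog C (c - 1) (q - 1) (t_of p))))) (at p)"
    if "p \<in> carrier S" for p c q
    using that by (intro has_derivative_of_real_t_of plog_deriv) (simp add: carrier_S)
  have "Ck_on k (carrier S) (\<lambda>p. complex_of_real (plog C c q (t_of p)))" for k
  proof (induction k arbitrary: c q)
    case 0
    have "(\<lambda>p. complex_of_real (plog C c q (t_of p))) differentiable (at p)" if "p \<in> carrier S" for p
      using d[OF that] by (rule differentiableI)
    then show ?case
      unfolding Ck_on.simps
      by (intro continuous_at_imp_continuous_on ballI differentiable_imp_continuous_within)
  next
    case (Suc k)
    have eq: "frechet_derivative (\<lambda>p. complex_of_real (plog C c q (t_of p))) (at p) v =
        of_real (t_of v * c) * of_real (plog C (c - 1) q (t_of p)) +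
        of_real (t_of v * real q) * of_real (plog C (c - 1) (q - 1) (t_of p))" if "p \<in> carrier S" for p v
      by (subst frechet_derivative_eq[OF d[OF that]]) (simp add: algebra_simps)
    have "Ck_on k (carrier S) (\<lambda>p. frechet_derivative (\<lambda>p. complex_of_real (plog C c q (t_of p))) (at p) v)" for v
      by (subst Ck_on_cong[OF open_carrier eq], assumption)
         (intro Ck_on_add Ck_on_mult Ck_on_const open_carrier Suc.IH)
    moreover have "(\<lambda>p. complex_of_real (plog C c q (t_of p))) differentiable (at p)" if "p \<in> carrier S" for p
      using d[OF that] by (rule differentiableI)
    ultimately show ?case by simp
  qed
  then show ?thesis by (simp add: smooth_on_def)
qed

end

section \<open>Recursion for the family built from a tension tree\<close>

locale finite_tension_tree = iwasawa_chart S g N m lam idx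
  for S :: "('k::finite) coords monoid"
    and g :: "'k coords \<Rightarrow> 'k coords \<Rightarrow> 'k coords \<Rightarrow> real"
    and N :: "(real ^ 'k) monoid"
    and m :: nat
    and lam :: "nat \<Rightarrow> real"
    and idx :: "'k \<Rightarrow> nat" +
  fixes h :: "real ^ 'k \<Rightarrow> complex"
    and H :: "nat list \<Rightarrow> real ^ 'k \<Rightarrow> complex"
    and r :: nat
  assumes smooth_h: "smooth_on (carrier S) (h \<circ> x_of)"
    and h_nonzero: "\<exists>x. h x \<noteq> 0"
    and tree: "tension_tree S g m lam h H"
    and vanish: "tree_vanishes_at m H (Suc r)"
begin

text \<open>Places \<open>h\<close> at the root of the tree, so that the separate term with
  \<open>h\<close> becomes level 0 of one sum.\<close>

definition hT :: "nat list \<Rightarrow> real ^ 'k \<Rightarrow> complex" where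
  "hT \<alpha> = (if \<alpha> = [] then h else H \<alpha>)"

text \<open>The power of t in front of the \<alpha>-term: twice \<Lambda> for \<nu> =
  \<open>hdim\<close>, and \<open>hdim\<close> more for \<nu> = -\<open>hdim\<close>.\<close>

definition expo :: "real \<Rightarrow> nat list \<Rightarrow> real" where
  "expo \<nu> \<alpha> = (hdim - \<nu>) / 2 + 2 * Lam lam \<alpha> (length \<alpha>)"

definition efun :: "real \<Rightarrow> nat list \<Rightarrow> nat \<Rightarrow> real \<Rightarrow> real" where
  "efun \<nu> \<alpha> = plog (tcoef lam \<nu> \<alpha>) (expo \<nu> \<alpha>)"

text \<open>Up to a shift of the index, \<open>Phi hdim\<close> is the family of the \<open>\<phi>\<close> and \<open>Phi (- hdim)\<close> that of the \<open>\<psi>\<close>.\<close>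

definition Phi :: "real \<Rightarrow> nat \<Rightarrow> 'k coords \<Rightarrow> complex" where
  "Phi \<nu> q p = (\<Sum>i\<le>r. \<Sum>\<alpha>\<in>multi_idx m i. of_real (efun \<nu> \<alpha> q (t_of p)) * hT \<alpha> (x_of p))"

text \<open>Nonresonance for both signs of \<nu>, put on the factor by which the step from a parent
  index to \<alpha> divides.\<close>

definition admissible :: "real \<Rightarrow> bool" where
  "admissible \<nu> \<longleftrightarrow> \<nu>\<^sup>2 = hdim\<^sup>2 \<and>
     (\<forall>i \<alpha> x. \<alpha> \<in> multi_idx m i \<longrightarrow> \<alpha> \<noteq> [] \<longrightarrow> H \<alpha> x \<noteq> 0 \<longrightarrow> 2 * Lam lam \<alpha> (length \<alpha>) - \<nu> \<noteq> 0)"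

lemma Lam_pos: "\<alpha> \<in> multi_idx m i \<Longrightarrow> 0 < k \<Longrightarrow> k \<le> i \<Longrightarrow> Lam lam \<alpha> k > 0"
  unfolding Lam_def by (rule sum_pos) (auto intro!: lam_pos multi_idx_nth)

lemma smooth_hT:
  assumes "\<alpha> \<in> multi_idx m i"
  shows "smooth_on (carrier S) (hT \<alpha> \<circ> x_of)"
proof (cases "\<alpha> = []")
  case False
  then have "i \<ge> 1" using assms by (cases i) (auto simp: multi_idx_def)
  then show ?thesis using tree assms False by (auto simp: tension_tree_def hT_def)
qed (simp add: hT_def smooth_h)

lemma tau_hT:
  assumes "\<alpha> \<in> multi_idx m i" "p \<in> carrier S"
  shows "tau g (hT \<alpha> \<circ> x_of) p =
    (\<Sum>k=1..m. H (\<alpha> @ [k]) (x_of p) * of_real (t_of p powr (2 * lam k)))"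
proof (cases "\<alpha> = []")
  case True
  then show ?thesis using tree assms(2) unfolding tension_tree_def hT_def by simp
next
  case False
  then have "i \<ge> 1" using assms by (cases i) (auto simp: multi_idx_def)
  then show ?thesis using tree assms False unfolding tension_tree_def hT_def by simp
qed

lemma smooth_term:
  "\<alpha> \<in> multi_idx m i \<Longrightarrow> smooth_on (carrier S) (\<lambda>p. of_real (efun \<nu> \<alpha> q (t_of p)) * hT \<alpha> (x_of p))"
  unfolding efun_def
  by (rule smooth_on_mult[OF open_carrier smooth_plog smooth_hT[unfolded comp_def]])

lemma smooth_Phi: "smooth_on (carrier S) (Phi \<nu> q)"
  unfolding Phi_def[abs_def] by (intro smooth_on_sum open_carrier smooth_term)

lemma smooth_Ck: "smooth_on U f \<Longrightarrow> Ck_on k U f"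
  by (simp add: smooth_on_def)

text \<open>The first line passes to the children of \<alpha>, the second is to cancel against the
  first line of the parent, and the third is the recursion in q with coefficients common to all
  \<alpha>.\<close>

lemma lapl_term:
  assumes \<nu>: "\<nu>\<^sup>2 = hdim\<^sup>2" and \<alpha>: "\<alpha> \<in> multi_idx m i" and p: "p \<in> carrier S"
  defines "L \<equiv> Lam lam \<alpha> (length \<alpha>)" and "t \<equiv> t_of p"
  shows "lapl (\<lambda>p. of_real (efun \<nu> \<alpha> q (t_of p)) * hT \<alpha> (x_of p)) p =
    of_real (efun \<nu> \<alpha> q t) * (\<Sum>k=1..m. H (\<alpha> @ [k]) (x_of p) * of_real (t powr (2 * lam k))) +
    of_real (2 * L * (2 * L - \<nu>) * efun \<nu> \<alpha> q t + 4 * L * (real q * efun \<nu> \<alpha> (q - 1) t)) * hT \<alpha> (x_of p) +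
    of_real (real q * (real (q - 1) * efun \<nu> \<alpha> (q - 2) t) - \<nu> * (real q * efun \<nu> \<alpha> (q - 1) t)) * hT \<alpha> (x_of p)"
proof -
  let ?C = "tcoef lam \<nu> \<alpha>" and ?c = "expo \<nu> \<alpha>"
  let ?u' = "\<lambda>t. ?c * plog ?C (?c - 1) q t + real q * plog ?C (?c - 1) (q - 1) t"
  let ?u'' = "\<lambda>t. ?c * ((?c - 1) * plog ?C (?c - 1 - 1) q t + real q * plog ?C (?c - 1 - 1) (q - 1) t) +
           real q * ((?c - 1) * plog ?C (?c - 1 - 1) (q - 1) t + real (q - 1) * plog ?C (?c - 1 - 1) (q - 1 - 1) t)"
  have t: "t > 0" using p by (simp add: carrier_S t_def)
  have 1: "(plog ?C ?c q has_real_derivative ?u' t) (at t)" if "t > 0" for t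
    by (rule plog_deriv[OF that])
  have 2: "(?u' has_real_derivative ?u'' t) (at t)" if "t > 0" for t
    by (intro DERIV_add DERIV_cmult plog_deriv[OF that])
  have "lapl (\<lambda>p. of_real (efun \<nu> \<alpha> q (t_of p)) * hT \<alpha> (x_of p)) p =
     of_real (plog ?C ?c q t) * tau g (hT \<alpha> \<circ> x_of) p +
     of_real (t\<^sup>2 * ?u'' t + (1 - hdim) * t * ?u' t) * hT \<alpha> (x_of p)"
    unfolding efun_def t_def
    by (rule tau_separated[OF 1 2 smooth_Ck[OF smooth_plog] smooth_Ck[OF smooth_hT[OF \<alpha>]] p])
  also have "t\<^sup>2 * ?u'' t + (1 - hdim) * t * ?u' t =
     2 * L * (2 * L - \<nu>) * efun \<nu> \<alpha> q t + 4 * L * (real q * efun \<nu> \<alpha> (q - 1) t) +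
     (real q * (real (q - 1) * efun \<nu> \<alpha> (q - 2) t) - \<nu> * (real q * efun \<nu> \<alpha> (q - 1) t))"
    unfolding efun_def by (rule plog_operator[OF t \<nu>]) (simp add: expo_def L_def)
  finally show ?thesis
    by (simp only: tau_hT[OF \<alpha> p] of_real_add ring_distribs t_def efun_def add.assoc)
qed

lemma efun_snoc:
  assumes adm: "admissible \<nu>" and \<beta>: "\<beta> \<in> multi_idx m i" and l: "l \<in> {1..m}" and nz: "H (\<beta> @ [l]) x \<noteq> 0"
  defines "\<alpha> \<equiv> \<beta> @ [l]"
  defines "L \<equiv> Lam lam \<alpha> (length \<alpha>)"
  shows "2 * L * (2 * L - \<nu>) * efun \<nu> \<alpha> q t + 4 * L * (real q * efun \<nu> \<alpha> (q - 1) t) =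
     - (t powr (2 * lam l) * efun \<nu> \<beta> q t)"
proof -
  have len: "length \<alpha> = Suc (length \<beta>)" by (simp add: \<alpha>_def)
  have \<alpha>: "\<alpha> \<in> multi_idx m (Suc i)" using \<beta> l by (simp add: \<alpha>_def multi_idx_def)
  have "length \<alpha> = Suc i" using \<alpha> by (simp add: multi_idx_def)
  then have L: "L \<noteq> 0"
    using Lam_pos[OF \<alpha>, of "Suc i"] by (simp add: L_def)
  have "\<alpha> \<noteq> []" by (simp add: \<alpha>_def)
  then have d: "2 * L - \<nu> \<noteq> 0"
    using adm \<alpha> nz unfolding admissible_def L_def \<alpha>_def by blast
  have rec: "2 * L * (2 * L - \<nu>) * appell (tcoef lam \<nu> \<alpha>) q s =
     - appell (tcoef lam \<nu> \<beta>) q s - 4 * L * (real q * appell (tcoef lam \<nu> \<alpha>) (q - 1) s)" for s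
    using L d unfolding L_def len unfolding \<alpha>_def by (intro appell_recurrence tcoef_snoc)
  have "2 * L * (2 * L - \<nu>) * efun \<nu> \<alpha> q t + 4 * L * (real q * efun \<nu> \<alpha> (q - 1) t) =
     t powr expo \<nu> \<alpha> * (2 * L * (2 * L - \<nu>) * appell (tcoef lam \<nu> \<alpha>) q (ln t) +
        4 * L * (real q * appell (tcoef lam \<nu> \<alpha>) (q - 1) (ln t)))"
    by (simp add: efun_def plog_def algebra_simps)
  also have "\<dots> = - (t powr expo \<nu> \<alpha> * appell (tcoef lam \<nu> \<beta>) q (ln t))"
    by (simp only: rec) simp
  also have "expo \<nu> \<alpha> = 2 * lam l + expo \<nu> \<beta>"
    using Lam_snoc[of lam \<beta> l] by (simp add: expo_def \<alpha>_def)
  finally show ?thesis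
    by (simp add: efun_def plog_def powr_add mult.assoc)
qed

text \<open>A telescoping over the levels of the tree: the \<open>V\<close> terms of level i + 1
  cancel the \<open>T\<close> terms of level i, and the \<open>R\<close> terms form the right-hand
  side.\<close>

lemma lapl_Phi:
  assumes adm: "admissible \<nu>" and p: "p \<in> carrier S"
  shows "lapl (Phi \<nu> q) p =
    of_nat q * (of_nat (q - 1) * Phi \<nu> (q - 2) p) - of_real \<nu> * (of_nat q * Phi \<nu> (q - 1) p)"
proof -
  define t where "t = t_of p"
  define x where "x = x_of p"
  let ?L = "\<lambda>\<alpha>. Lam lam \<alpha> (length \<alpha>)"
  let ?e = "\<lambda>\<alpha> q. efun \<nu> \<alpha> q t"
  define T where "T \<alpha> = complex_of_real (?e \<alpha> q) * (\<Sum>k=1..m. H (\<alpha> @ [k]) x * of_real (t powr (2 * lam k)))" for \<alpha>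
  define V where "V \<alpha> = complex_of_real (2 * ?L \<alpha> * (2 * ?L \<alpha> - \<nu>) * ?e \<alpha> q + 4 * ?L \<alpha> * (real q * ?e \<alpha> (q - 1))) * hT \<alpha> x" for \<alpha>
  define R where "R \<alpha> = complex_of_real (real q * (real (q - 1) * ?e \<alpha> (q - 2)) - \<nu> * (real q * ?e \<alpha> (q - 1))) * hT \<alpha> x" for \<alpha>
  have \<nu>: "\<nu>\<^sup>2 = hdim\<^sup>2" using adm by (simp add: admissible_def)
  have "lapl (Phi \<nu> q) p = (\<Sum>i\<le>r. lapl (\<lambda>p. \<Sum>\<alpha>\<in>multi_idx m i. of_real (efun \<nu> \<alpha> q (t_of p)) * hT \<alpha> (x_of p)) p)"
    unfolding Phi_def[abs_def]
    by (rule lapl_sum[OF _ p]) (intro smooth_Ck smooth_on_sum open_carrier smooth_term)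
  also have "\<dots> = (\<Sum>i\<le>r. \<Sum>\<alpha>\<in>multi_idx m i. lapl (\<lambda>p. of_real (efun \<nu> \<alpha> q (t_of p)) * hT \<alpha> (x_of p)) p)"
    by (intro sum.cong refl lapl_sum[OF _ p] smooth_Ck smooth_term)
  also have "\<dots> = (\<Sum>i\<le>r. \<Sum>\<alpha>\<in>multi_idx m i. T \<alpha> + V \<alpha> + R \<alpha>)"
    by (intro sum.cong refl) (simp only: lapl_term[OF \<nu> _ p] T_def V_def R_def t_def x_def)
  also have "\<dots> = (\<Sum>i\<le>r. \<Sum>\<alpha>\<in>multi_idx m i. T \<alpha>) + (\<Sum>i\<le>r. \<Sum>\<alpha>\<in>multi_idx m i. V \<alpha>) + (\<Sum>i\<le>r. \<Sum>\<alpha>\<in>multi_idx m i. R \<alpha>)"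
    by (simp only: sum.distrib)
  also have "(\<Sum>i\<le>r. \<Sum>\<alpha>\<in>multi_idx m i. R \<alpha>) =
     of_nat q * (of_nat (q - 1) * Phi \<nu> (q - 2) p) - of_real \<nu> * (of_nat q * Phi \<nu> (q - 1) p)"
    unfolding Phi_def sum_distrib_left sum_subtractf[symmetric]
    by (intro sum.cong refl) (simp add: R_def t_def x_def algebra_simps)
  also have "(\<Sum>i\<le>r. \<Sum>\<alpha>\<in>multi_idx m i. V \<alpha>) = - (\<Sum>i\<le>r. \<Sum>\<alpha>\<in>multi_idx m i. T \<alpha>)"
  proof -
    \<comment> \<open>The top level has no children: this is where the finite degree enters.\<close>
    have "(\<Sum>\<alpha>\<in>multi_idx m r. T \<alpha>) = 0"
    proof (rule sum.neutral, rule ballI)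
      fix \<alpha> assume \<alpha>: "\<alpha> \<in> multi_idx m r"
      have "H (\<alpha> @ [k]) x = 0" if "k \<in> {1..m}" for k
      proof -
        have "\<alpha> @ [k] \<in> multi_idx m (Suc r)" using \<alpha> that by (simp add: multi_idx_def)
        then show ?thesis using vanish unfolding tree_vanishes_at_def by blast
      qed
      then show "T \<alpha> = 0" by (simp add: T_def)
    qed
    then have "(\<Sum>i\<le>r. \<Sum>\<alpha>\<in>multi_idx m i. T \<alpha>) = (\<Sum>i<r. \<Sum>\<alpha>\<in>multi_idx m i. T \<alpha>)"
      by (simp flip: lessThan_Suc_atMost)
    \<comment> \<open>The root contributes nothing, since \<open>Lam\<close> is 0 at the empty
      index.\<close>
    moreover have "(\<Sum>i\<le>r. \<Sum>\<alpha>\<in>multi_idx m i. V \<alpha>) = (\<Sum>i<r. \<Sum>\<alpha>\<in>multi_idx m (Suc i). V \<alpha>)"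
      by (simp add: sum.atMost_shift multi_idx_0 V_def Lam_def)
    moreover have "(\<Sum>\<alpha>\<in>multi_idx m (Suc i). V \<alpha>) = - (\<Sum>\<beta>\<in>multi_idx m i. T \<beta>)" for i
    proof -
      have "V (\<beta> @ [l]) = - (of_real (?e \<beta> q) * (H (\<beta> @ [l]) x * of_real (t powr (2 * lam l))))"
        if "\<beta> \<in> multi_idx m i" "l \<in> {1..m}" for \<beta> l
      \<comment> \<open>Where the child vanishes its denominator may be 0, but then both sides are
        0.\<close>
      proof (cases "H (\<beta> @ [l]) x = 0")
        case True
        then show ?thesis by (simp add: V_def hT_def)
      next
        case False
        show ?thesis
          unfolding V_def efun_snoc[OF adm that False] by (simp add: hT_def)
      qed
      then have "(\<Sum>\<beta>\<in>multi_idx m i. \<Sum>l=1..m. V (\<beta> @ [l])) =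
          (\<Sum>\<beta>\<in>multi_idx m i. \<Sum>l=1..m. - (of_real (?e \<beta> q) * (H (\<beta> @ [l]) x * of_real (t powr (2 * lam l)))))"
        by (intro sum.cong refl)
      then show ?thesis
        by (simp only: sum_multi_idx_Suc T_def sum_negf sum_distrib_left)
    qed
    ultimately show ?thesis by (simp only: sum_negf)
  qed
  finally show ?thesis by simp
qed

section \<open>Iterated tension field of linear combinations\<close>

definition dstep :: "(real \<Rightarrow> nat \<Rightarrow> complex) \<Rightarrow> real \<Rightarrow> nat \<Rightarrow> complex" where
  "dstep c \<nu> i = c \<nu> (Suc (Suc i)) * of_nat (Suc (Suc i)) * of_nat (Suc i) - of_real \<nu> * (c \<nu> (Suc i) * of_nat (Suc i))"

text \<open>The bound \<open>K\<close> stays fixed under \<open>tau\<close>, so that all iterates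
  have the same shape.\<close>

definition lincomb :: "real set \<Rightarrow> nat \<Rightarrow> (real \<Rightarrow> nat \<Rightarrow> complex) \<Rightarrow> 'k coords \<Rightarrow> complex" where
  "lincomb I K c p = (\<Sum>\<nu>\<in>I. \<Sum>i\<le>K. c \<nu> i * Phi \<nu> i p)"

lemma smooth_lincomb: "smooth_on (carrier S) (lincomb I K c)"
  unfolding lincomb_def[abs_def]
  by (intro smooth_on_sum smooth_on_mult smooth_on_const smooth_Phi open_carrier)

lemma lapl_scale:
  assumes "Ck_on 2 (carrier S) f" "p \<in> carrier S"
  shows "lapl (\<lambda>p. c * f p) p = c * lapl f p"
proof -
  have "pd j (\<lambda>p. c) = (\<lambda>p. 0 :: complex)" for j :: "'k option"
    by (rule ext) simp
  then show ?thesis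
    using lapl_mult[OF Ck_on_const assms, of c] by (simp add: lapl_def)
qed

text \<open>If P is the polynomial with coefficients \<open>c \<nu>\<close>, then
  \<open>dstep c \<nu>\<close> are those of P'' - \<nu> P'. Thus \<open>tau\<close> becomes this
  operator on polynomials.\<close>

lemma tau_lincomb:
  assumes p: "p \<in> carrier S" and adm: "\<And>\<nu>. \<nu> \<in> I \<Longrightarrow> admissible \<nu>"
    and c: "\<And>\<nu> i. i > K \<Longrightarrow> c \<nu> i = 0"
  shows "tau g (lincomb I K c) p = lincomb I K (dstep c) p"
proof -
  have smooth: "smooth_on (carrier S) (\<lambda>p. c \<nu> i * Phi \<nu> i p)" for \<nu> i
    by (intro smooth_on_mult smooth_on_const smooth_Phi open_carrier)
  have "tau g (lincomb I K c) p = lapl (lincomb I K c) p"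
    by (rule tau_frame[OF smooth_Ck[OF smooth_lincomb] p])
  also have "\<dots> = (\<Sum>\<nu>\<in>I. lapl (\<lambda>p. \<Sum>i\<le>K. c \<nu> i * Phi \<nu> i p) p)"
    unfolding lincomb_def[abs_def]
    by (rule lapl_sum[OF _ p]) (intro smooth_Ck smooth_on_sum open_carrier smooth)
  also have "\<dots> = (\<Sum>\<nu>\<in>I. \<Sum>i\<le>K. lapl (\<lambda>p. c \<nu> i * Phi \<nu> i p) p)"
    by (intro sum.cong refl lapl_sum[OF _ p] smooth_Ck smooth)
  also have "\<dots> = lincomb I K (dstep c) p"
    unfolding lincomb_def
  proof (rule sum.cong[OF refl])
    fix \<nu> assume \<nu>: "\<nu> \<in> I"
    let ?c' = "\<lambda>i. c \<nu> (Suc i) * of_nat (Suc i)"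
    have "(\<Sum>i\<le>K. lapl (\<lambda>p. c \<nu> i * Phi \<nu> i p) p) =
       (\<Sum>i\<le>K. c \<nu> i * (of_nat i * (of_nat (i - 1) * Phi \<nu> (i - 1 - 1) p))) -
       of_real \<nu> * (\<Sum>i\<le>K. c \<nu> i * (of_nat i * Phi \<nu> (i - 1) p))"
      by (simp add: lapl_scale[OF smooth_Ck[OF smooth_Phi] p] lapl_Phi[OF adm[OF \<nu>] p]
          sum_distrib_left sum_subtractf right_diff_distrib mult.left_commute numeral_2_eq_2)
    also have "(\<Sum>i\<le>K. c \<nu> i * (of_nat i * (of_nat (i - 1) * Phi \<nu> (i - 1 - 1) p))) =
        (\<Sum>i\<le>K. ?c' i * (of_nat i * Phi \<nu> (i - 1) p))"
      by (rule sum_shift) (simp add: c)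
    also have "\<dots> = (\<Sum>i\<le>K. ?c' (Suc i) * of_nat (Suc i) * Phi \<nu> i p)"
      by (rule sum_shift) (simp add: c)
    also have "(\<Sum>i\<le>K. c \<nu> i * (of_nat i * Phi \<nu> (i - 1) p)) = (\<Sum>i\<le>K. ?c' i * Phi \<nu> i p)"
      by (rule sum_shift) (simp add: c)
    finally show "(\<Sum>i\<le>K. lapl (\<lambda>p. c \<nu> i * Phi \<nu> i p) p) = (\<Sum>i\<le>K. dstep c \<nu> i * Phi \<nu> i p)"
      by (simp only: dstep_def left_diff_distrib sum_subtractf sum_distrib_left mult.assoc)
  qed
  finally show ?thesis .
qed

lemma dstep_vanish:
  assumes "\<And>\<nu> i. i > K \<Longrightarrow> c \<nu> i = 0"
  shows "i + j > K \<Longrightarrow> (dstep ^^ j) c \<nu> i = 0"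
proof (induction j arbitrary: i)
  case 0
  then show ?case using assms by simp
next
  case (Suc j)
  have "(dstep ^^ j) c \<nu> (Suc i) = 0" "(dstep ^^ j) c \<nu> (Suc (Suc i)) = 0"
    using Suc.prems by (auto intro: Suc.IH)
  then show ?case by (simp add: dstep_def[of "(dstep ^^ j) c"])
qed

text \<open>Only - \<nu> P' reaches the new top degree, so each step lowers the degree by exactly
  one.\<close>

lemma dstep_leading:
  assumes "\<And>\<nu> i. i > K \<Longrightarrow> c \<nu> i = 0" "c \<nu> K \<noteq> 0" "\<nu> \<noteq> 0"
  shows "i + j = K \<Longrightarrow> (dstep ^^ j) c \<nu> i \<noteq> 0"
proof (induction j arbitrary: i)
  case 0
  then show ?case using assms by simp
next
  case (Suc j)
  have "(dstep ^^ j) c \<nu> (Suc (Suc i)) = 0"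
    using Suc.prems by (intro dstep_vanish[OF assms(1)]) auto
  moreover have "(dstep ^^ j) c \<nu> (Suc i) \<noteq> 0"
    using Suc.prems by (intro Suc.IH) simp
  ultimately show ?case using assms(3) by (simp add: dstep_def[of "(dstep ^^ j) c"] del: of_nat_Suc)
qed

lemma tau_iter_lincomb:
  assumes adm: "\<And>\<nu>. \<nu> \<in> I \<Longrightarrow> admissible \<nu>"
    and c: "\<And>\<nu> i. i > K \<Longrightarrow> c \<nu> i = 0"
    and f: "\<And>p. p \<in> carrier S \<Longrightarrow> f p = lincomb I K c p"
  shows "p \<in> carrier S \<Longrightarrow> (tau g ^^ j) f p = lincomb I K ((dstep ^^ j) c) p"
proof (induction j arbitrary: p)
  case 0
  then show ?case by (simp add: f)
next
  case (Suc j)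
  have "tau g ((tau g ^^ j) f) p = tau g (lincomb I K ((dstep ^^ j) c)) p"
    by (rule tau_cong[OF open_carrier Suc.prems Suc.IH])
  also have "\<dots> = lincomb I K (dstep ((dstep ^^ j) c)) p"
    by (rule tau_lincomb[OF Suc.prems adm dstep_vanish[OF c]]) auto
  finally show ?case by simp
qed

text \<open>For q = 0 no logarithms occur. The least exponent belongs to the root and the larger
  \<nu> in \<open>I\<close>; its coefficient is \<open>C \<nu> * h x\<close>.\<close>

lemma Phi_combination_nonzero:
  assumes I: "I \<subseteq> {hdim, - hdim}" "I \<noteq> {}" and C: "\<And>\<nu>. \<nu> \<in> I \<Longrightarrow> C \<nu> \<noteq> 0"
  shows "\<exists>p\<in>carrier S. (\<Sum>\<nu>\<in>I. C \<nu> * Phi \<nu> 0 p) \<noteq> 0"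
proof (rule ccontr)
  assume "\<not> ?thesis"
  then have zero: "(\<Sum>\<nu>\<in>I. C \<nu> * Phi \<nu> 0 (pt t x)) = 0" if "t > 0" for t x
    using that by (simp add: carrier_S)
  obtain x where x: "h x \<noteq> 0" using h_nonzero by blast
  \<comment> \<open>The maximum of \<open>I\<close>, as (\<open>hdim\<close> - \<nu>)/2 decreases in
    \<nu>.\<close>
  define \<nu>0 where "\<nu>0 = (if hdim \<in> I then hdim else - hdim)"
  have \<nu>0: "\<nu>0 \<in> I" using I by (auto simp: \<nu>0_def)
  have finI: "finite I" using I(1) by (rule finite_subset) simp
  define J where "J = I \<times> Sigma {..r} (multi_idx m)"
  define k where "k = (\<lambda>(\<nu>, i :: nat, \<alpha>). of_real (tcoef lam \<nu> \<alpha> 0) * hT \<alpha> x * C \<nu>)"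
  define \<epsilon> where "\<epsilon> = (\<lambda>(\<nu>, i :: nat, \<alpha>). expo \<nu> \<alpha>)"
  have "k (\<nu>0, 0, []) = 0"
  proof (rule leading_coeff_zero[of J _ \<epsilon>])
    show "finite J"
      unfolding J_def by (intro finite_cartesian_product finI finite_SigmaI finite_multi_idx finite_atMost)
    show "(\<nu>0, 0, []) \<in> J" using \<nu>0 by (simp add: J_def multi_idx_0)
    show "\<epsilon> (\<nu>0, 0, []) < \<epsilon> s" if "s \<in> J" "s \<noteq> (\<nu>0, 0, [])" for s
    proof -
      obtain \<nu> i \<alpha> where s: "s = (\<nu>, i, \<alpha>)" by (cases s) auto
      then have s': "\<nu> \<in> I" "\<alpha> \<in> multi_idx m i" using that(1) by (auto simp: J_def)
      have \<nu>: "\<nu> \<le> \<nu>0" using s'(1) I(1) hdim_pos by (auto simp: \<nu>0_def)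
      show ?thesis
      proof (cases "i = 0")
        case True
        then have "\<alpha> = []" using s'(2) by (simp add: multi_idx_0)
        then have "\<nu> < \<nu>0" using \<nu> that(2) s True by auto
        then show ?thesis by (simp add: s \<epsilon>_def expo_def \<open>\<alpha> = []\<close> Lam_def)
      next
        case False
        moreover have "length \<alpha> = i" using s'(2) by (simp add: multi_idx_def)
        ultimately have L: "2 * Lam lam \<alpha> (length \<alpha>) > 0"
          using Lam_pos[OF s'(2), of i] by simp
        have "(hdim - \<nu>0) / 2 \<le> (hdim - \<nu>) / 2"
          using \<nu> by (intro divide_right_mono) auto
        then have "(hdim - \<nu>0) / 2 + 0 < (hdim - \<nu>) / 2 + 2 * Lam lam \<alpha> (length \<alpha>)"
          using L by (rule add_le_less_mono)
        moreover have "\<epsilon> (\<nu>0, 0, []) = (hdim - \<nu>0) / 2 + 0"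
          by (simp add: \<epsilon>_def expo_def Lam_def[of _ "[]"])
        moreover have "\<epsilon> s = (hdim - \<nu>) / 2 + 2 * Lam lam \<alpha> (length \<alpha>)"
          by (simp add: s \<epsilon>_def expo_def)
        ultimately show ?thesis by (simp only:)
      qed
    qed
    show "(\<Sum>s\<in>J. of_real (t powr \<epsilon> s) * k s) = 0" if "t > 0" for t
    proof -
      have "(\<Sum>z\<in>Sigma {..r} (multi_idx m). F z) = (\<Sum>i\<le>r. \<Sum>\<alpha>\<in>multi_idx m i. F (i, \<alpha>))"
        for F :: "nat \<times> nat list \<Rightarrow> complex"
        by (subst sum.Sigma) (auto simp: finite_multi_idx split_def)
      then have "(\<Sum>s\<in>J. of_real (t powr \<epsilon> s) * k s) =
          (\<Sum>\<nu>\<in>I. \<Sum>i\<le>r. \<Sum>\<alpha>\<in>multi_idx m i. of_real (t powr \<epsilon> (\<nu>, i, \<alpha>)) * k (\<nu>, i, \<alpha>))"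
        unfolding J_def by (simp only: sum.cartesian_product')
      also have "\<dots> = (\<Sum>\<nu>\<in>I. C \<nu> * Phi \<nu> 0 (pt t x))"
        by (simp add: Phi_def efun_def plog_def appell_0 \<epsilon>_def k_def sum_distrib_left mult_ac)
      finally show ?thesis using zero[OF that] by simp
    qed
  qed
  then show False using x C[OF \<nu>0] by (simp add: k_def tcoef_Nil hT_def)
qed

text \<open>The coefficients start as monomials of degree \<open>K\<close>. After \<open>K\<close>
  steps nonzero constants remain, that is, a combination of the \<open>Phi \<nu> 0\<close>; one more
  step annihilates them.\<close>

lemma proper_p_harmonic_combination:
  assumes I: "I \<subseteq> {hdim, - hdim}" "I \<noteq> {}" and C: "\<And>\<nu>. \<nu> \<in> I \<Longrightarrow> C \<nu> \<noteq> 0"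
    and adm: "\<And>\<nu>. \<nu> \<in> I \<Longrightarrow> admissible \<nu>"
    and f: "\<And>p. p \<in> carrier S \<Longrightarrow> f p = (\<Sum>\<nu>\<in>I. C \<nu> * Phi \<nu> K p)"
  shows "proper_p_harmonic_on (carrier S) g (Suc K) f"
proof -
  define c where "c \<nu> i = (if i = K \<and> \<nu> \<in> I then C \<nu> else 0)" for \<nu> i
  have c: "c \<nu> i = 0" if "i > K" for \<nu> i using that by (simp add: c_def)
  have f': "f p = lincomb I K c p" if "p \<in> carrier S" for p
  proof -
    have "(\<Sum>i\<le>K. c \<nu> i * Phi \<nu> i p) = C \<nu> * Phi \<nu> K p" if "\<nu> \<in> I" for \<nu>
    proof -
      have "(\<Sum>i\<le>K. c \<nu> i * Phi \<nu> i p) = (\<Sum>i\<le>K. if i = K then C \<nu> * Phi \<nu> K p else 0)"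
        by (rule sum.cong) (auto simp: c_def that)
      then show ?thesis by simp
    qed
    then show ?thesis using f[OF that] by (simp add: lincomb_def)
  qed
  note iter = tau_iter_lincomb[OF adm c f']
  have "(tau g ^^ Suc K) f p = 0" if "p \<in> carrier S" for p
    by (simp only: iter[OF _ _ _ that]) (simp add: lincomb_def dstep_vanish[OF c] del: funpow.simps)
  moreover have "smooth_on (carrier S) f"
    using smooth_on_cong[OF open_carrier, of f "lincomb I K c"] f' smooth_lincomb by blast
  moreover have "\<exists>p\<in>carrier S. (tau g ^^ K) f p \<noteq> 0"
  proof -
    have "(tau g ^^ K) f p = (\<Sum>\<nu>\<in>I. (dstep ^^ K) c \<nu> 0 * Phi \<nu> 0 p)" if "p \<in> carrier S" for p
    proof -
      have "(\<Sum>i\<le>K. (dstep ^^ K) c \<nu> i * Phi \<nu> i p) = (dstep ^^ K) c \<nu> 0 * Phi \<nu> 0 p" for \<nu>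
        by (subst sum.atMost_shift) (simp add: dstep_vanish[OF c])
      then show ?thesis by (simp add: iter[OF _ _ _ that] lincomb_def)
    qed
    moreover have "(dstep ^^ K) c \<nu> 0 \<noteq> 0" if "\<nu> \<in> I" for \<nu>
      using that C I(1) hdim_pos by (intro dstep_leading[OF c]) (auto simp: c_def)
    ultimately show ?thesis
      using Phi_combination_nonzero[OF I, of "\<lambda>\<nu>. (dstep ^^ K) c \<nu> 0"] by auto
  qed
  ultimately show ?thesis
    unfolding proper_p_harmonic_on_def p_harmonic_on_def by simp
qed

section \<open>Identification with the functions of the theorem\<close>

lemma Phi_split:
  "Phi \<nu> q p = of_real (efun \<nu> [] q (t_of p)) * h (x_of p) +
    (\<Sum>i=1..r. \<Sum>\<alpha>\<in>multi_idx m i. H \<alpha> (x_of p) * of_real (efun \<nu> \<alpha> q (t_of p)))"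
proof -
  have "hT \<alpha> = H \<alpha>" if "\<alpha> \<in> multi_idx m (Suc i)" for \<alpha> i
    using that by (auto simp: hT_def multi_idx_def)
  then show ?thesis
    unfolding Phi_def One_nat_def sum.atLeast1_atMost_eq
    by (simp add: sum.atMost_shift multi_idx_0 hT_def[of "[]"] mult.commute)
qed

lemma efun_Nil: "efun \<nu> [] q t = t powr ((hdim - \<nu>) / 2) * ln t ^ q"
  by (simp add: efun_def plog_def appell_def tcoef_Nil expo_def Lam_def sum.atMost_shift)

lemma f_fun_efun: "f_fun lam hdim \<alpha> t (Suc q) = efun hdim \<alpha> q t"
  by (simp add: f_fun_plog efun_def expo_def)

lemma g_fun_efun: "g_fun lam hdim \<alpha> t (Suc q) = efun (- hdim) \<alpha> q t"
  by (simp add: g_fun_f_fun f_fun_plog plog_mult_powr efun_def expo_def)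

lemma phi_fun_Phi:
  assumes "p \<in> carrier S"
  shows "phi_fun m lam hdim h H r (Suc q) p = Phi hdim q p"
  using assms
  by (simp add: phi_fun_def Phi_split efun_Nil carrier_S f_fun_efun mult.commute)

lemma psi_fun_Phi:
  "psi_fun m lam hdim h H r (Suc q) p = Phi (- hdim) q p"
  by (simp add: psi_fun_def Phi_split efun_Nil g_fun_efun mult.commute)

lemma admissible_uminus: "admissible (- hdim)"
  unfolding admissible_def
proof (intro conjI allI impI)
  fix i \<alpha> assume \<alpha>: "\<alpha> \<in> multi_idx m i" "\<alpha> \<noteq> []"
  then have "Lam lam \<alpha> (length \<alpha>) > 0"
    using Lam_pos[OF \<alpha>(1), of i] by (auto simp: multi_idx_def)
  then show "2 * Lam lam \<alpha> (length \<alpha>) - - hdim \<noteq> 0"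
    using hdim_pos by simp
qed simp

lemma nonresonant_admissible:
  assumes "nonresonant m lam hdim H"
  shows "admissible hdim"
  unfolding admissible_def
proof (intro conjI allI impI)
  fix i \<alpha> x assume \<alpha>: "\<alpha> \<in> multi_idx m i" "\<alpha> \<noteq> []" "H \<alpha> x \<noteq> 0"
  have len: "length \<alpha> = i" using \<alpha>(1) by (simp add: multi_idx_def)
  then have i: "i \<ge> 1" using \<alpha>(2) by (cases i) auto
  then have "(\<Prod>k=1..i. 2 * Lam lam \<alpha> k - hdim) \<noteq> 0"
    using assms \<alpha> unfolding nonresonant_def by blast
  then show "2 * Lam lam \<alpha> (length \<alpha>) - hdim \<noteq> 0"
    using i by (simp add: len)
qed simp

lemma proper_p_harmonic_phi_psi:
  assumes "(a, b) \<noteq> (0, 0)" and a: "a \<noteq> 0 \<Longrightarrow> nonresonant m lam hdim H"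
  shows "proper_p_harmonic_on (carrier S) g (Suc K)
    (\<lambda>q. a * phi_fun m lam hdim h H r (Suc K) q + b * psi_fun m lam hdim h H r (Suc K) q)"
proof -
  define C where "C \<nu> = (if \<nu> = hdim then a else b)" for \<nu>
  \<comment> \<open>Dropping zero coefficients keeps nonresonance tied to the presence of
    \<open>phi_fun\<close>, and gives the leading terms nonzero coefficients.\<close>
  define I where "I = {\<nu> \<in> {hdim, - hdim}. C \<nu> \<noteq> 0}"
  have ne: "hdim \<noteq> - hdim" using hdim_pos by simp
  have C: "C hdim = a" "C (- hdim) = b" using ne by (auto simp: C_def)
  show ?thesis
  proof (rule proper_p_harmonic_combination[of I C])
    show "I \<noteq> {}" using assms(1) C by (auto simp: I_def)
    show "admissible \<nu>" if "\<nu> \<in> I" for \<nu>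
      using that nonresonant_admissible[OF a] admissible_uminus C by (auto simp: I_def)
    fix p assume p: "p \<in> carrier S"
    have "(\<Sum>\<nu>\<in>I. C \<nu> * Phi \<nu> K p) = (\<Sum>\<nu>\<in>{hdim, - hdim}. C \<nu> * Phi \<nu> K p)"
      by (rule sum.mono_neutral_left) (auto simp: I_def)
    also have "\<dots> = a * Phi hdim K p + b * Phi (- hdim) K p"
      using ne C by simp
    finally show "a * phi_fun m lam hdim h H r (Suc K) p + b * psi_fun m lam hdim h H r (Suc K) p =
        (\<Sum>\<nu>\<in>I. C \<nu> * Phi \<nu> K p)"
      by (simp add: phi_fun_Phi[OF p] psi_fun_Phi)
  qed (auto simp: I_def)
qed

end

theorem theorem4p4:
  fixes S :: "('k::finite) coords monoid"
    and g :: "'k coords \<Rightarrow> 'k coords \<Rightarrow> 'k coords \<Rightarrow> real"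
    and N :: "(real ^ 'k) monoid"
    and m r p :: nat
    and lam :: "nat \<Rightarrow> real"
    and idx :: "'k \<Rightarrow> nat"
    and n :: real
    and h :: "real ^ 'k \<Rightarrow> complex"
    and H :: "nat list \<Rightarrow> real ^ 'k \<Rightarrow> complex"
  assumes "iwasawa_type S g"
    and "iwasawa_rank S g = 1"
    and "iwasawa_coordinates S g N m lam idx"
    and "n = (\<Sum>i=1..m. real (dim (eigenspace_ad S A_vec (lam i))) * lam i)"
    and "smooth_on (carrier S) (h \<circ> x_of)"
    and "\<exists>x. h x \<noteq> 0"
    and "tension_tree S g m lam h H"
    and "tree_has_degree m H r"
    and "p \<ge> 1"
  shows "(nonresonant m lam n H \<longrightarrow>
            proper_p_harmonic_on (carrier S) g p (phi_fun m lam n h H r p)) \<and>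
         proper_p_harmonic_on (carrier S) g p (psi_fun m lam n h H r p) \<and>
         (nonresonant m lam n H \<longrightarrow>
            (\<forall>a b. (a, b) \<noteq> (0 :: complex, 0 :: complex) \<longrightarrow>
               proper_p_harmonic_on (carrier S) g p
                 (\<lambda>q. a * phi_fun m lam n h H r p q + b * psi_fun m lam n h H r p q)))"
proof -
  interpret iwasawa_chart S g N m lam idx
    using assms(1,3) by unfold_locales
  interpret finite_tension_tree S g N m lam idx h H r
    using assms(5-8) by unfold_locales (simp_all add: tree_has_degree_def)
  have n: "n = hdim" using assms(4) hdim_eq by simp
  obtain K where p: "p = Suc K" using assms(9) by (cases p) auto
  note combination = proper_p_harmonic_phi_psi[where K = K]
  show ?thesis
    unfolding n p
  proof (intro conjI impI allI)
    assume res: "nonresonant m lam hdim H"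
    show "proper_p_harmonic_on (carrier S) g (Suc K) (phi_fun m lam hdim h H r (Suc K))"
      using combination[of 1 0] res by simp
    show "proper_p_harmonic_on (carrier S) g (Suc K)
        (\<lambda>q. a * phi_fun m lam hdim h H r (Suc K) q + b * psi_fun m lam hdim h H r (Suc K) q)"
      if "(a, b) \<noteq> (0, 0)" for a b
      using that res by (intro combination)
  next
    show "proper_p_harmonic_on (carrier S) g (Suc K) (psi_fun m lam hdim h H r (Suc K))"
      using combination[of 0 1] by simp
  qed
qed

end
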